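(* Let $K$ be an algebraically closed field of characteristic zero, $P_n=K[x_1,\ldots,x_n]$, and let $W_n=W_n(K)$ be the Lie algebra of all $K$-derivations of $P_n$. Let $M$ be a maximal subalgebra of the Lie algebra $W_n$ with $\mathrm{rk}\,M=n$. Then: (1) If $M$ is not a polynomial subalgebra and $M$ contains a nonzero ideal (of the Lie algebra $M$) of rank $\le n-1$, then $M$ has a unique maximal (by inclusion) polynomial ideal $M_0$; moreover $\mathrm{rk}(M_0)=k$ for some $k<n$, and the Lie algebra $M/M_0$ does not contain any nonzero ideals of rank $<n-k$. (2) If $M$ is a polynomial subalgebra, then $M$ contains a subalgebra $I W_n$ of rank $n$ for some ideal $I\subseteq P_n$ of the ring $P_n$.
   Context: Every element of $W_n(K)=\mathrm{Der}_K(P_n)$ is uniquely of the form $\sum_{i=1}^n f_i \frac{\partial}{\partial x_i}$ with $f_i\in P_n$; the bracket is the commutator of derivations, and $W_n(K)$ is a Lie algebra over $K$ and also a free $P_n$-module of rank $n$. Subalgebras and ideals are those of Lie algebras over $K$. A maximal subalgebra is a proper subalgebra not properly contained in any other proper subalgebra. Let $R_n=K(x_1,\ldots,x_n)$. For a $P_n$-module $N$, $\mathrm{rk}\,N=\dim_{R_n}(R_n\otimes_{P_n}N)$; the rank of a subset of a $P_n$-module is the rank of the submodule it generates. In particular, the rank of a subset of $W_n$ is taken in the $P_n$-module $W_n$, and the rank of an ideal of $M/M_0$ (where $M_0$ is a $P_n$-submodule of $W_n$) is the rank of it as a subset of the $P_n$-module $W_n/M_0$. A subalgebra (in particular, an ideal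 of a subalgebra) $L$ of $W_n$ is called polynomial if it is a $P_n$-submodule of $W_n$, i.e. $P_nL=L$. For an ideal $I$ of $P_n$, $IW_n$ denotes the set of all finite sums $\sum h_iD_i$ with $h_i\in I$, $D_i\in W_n$. *)

theory Defs
  imports
    "HOL-Library.Poly_Mapping"
    "HOL-Library.Cardinality"
    "HOL-Computational_Algebra.Fraction_Field"
    "HOL-Computational_Algebra.Polynomial"
    "HOL-Algebra.Ideal"
    "HOL-Algebra.Module"
    "Jordan_Normal_Form.VS_Connect"
begin

text \<open>Module records have (by inheritance from ring records) fields \<open>mult\<close> and \<open>one\<close>, which
  play no role for modules and are left undefined. The scalar rings are type-class rings, turned
  into records by \<open>class_ring\<close>. Both \<open>submodule\<close> and \<open>span\<close> (finite linear combinations)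
  are the notions of the VectorSpace library.\<close>

section \<open>Extension of scalars to the fraction field, and rank\<close>

text \<open>For a module \<open>N\<close> over a domain \<open>P\<close> with fraction field \<open>F\<close>, the \<open>F\<close>-vector space
  \<open>F \<otimes>\<^sub>P N\<close> is presented by the generators \<open>1 \<otimes> a\<close> with \<open>a \<in> N\<close> and the relations
  \<open>1 \<otimes> (a + b) = 1 \<otimes> a + 1 \<otimes> b\<close> and \<open>1 \<otimes> p a = p \<otimes> a\<close>.
  The generator \<open>r \<otimes> a\<close> is represented by \<open>single a r\<close>.\<close>

definition free_space :: "'v set \<Rightarrow> ('f::field, 'v \<Rightarrow>\<^sub>0 'f) module" where
  "free_space A = \<lparr>carrier = {\<phi>. Poly_Mapping.keys \<phi> \<subseteq> A}, mult = undefined, one = undefined,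
     zero = 0, add = (+), smult = (\<lambda>r. Poly_Mapping.map ((*) r))\<rparr>"

definition quotient_module ::
    "('r, 'v, 'z) module_scheme \<Rightarrow> 'v set \<Rightarrow> ('r, 'v set) module" where
  "quotient_module N U = \<lparr>carrier = a_rcosets\<^bsub>N\<^esub> U, mult = undefined, one = undefined,
     zero = U, add = (<+>\<^bsub>N\<^esub>),
     smult = (\<lambda>r A. \<Union>a\<in>A. U +>\<^bsub>N\<^esub> (r \<odot>\<^bsub>N\<^esub> a))\<rparr>"

definition tensor_relations ::
    "('p::idom, 'v, 'z) module_scheme \<Rightarrow> ('v \<Rightarrow>\<^sub>0 'p fract) set" where
  "tensor_relations N =
     {Poly_Mapping.single (a \<oplus>\<^bsub>N\<^esub> b) 1 - Poly_Mapping.single a 1 - Poly_Mapping.single b 1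
        | a b. a \<in> carrier N \<and> b \<in> carrier N} \<union>
     {Poly_Mapping.single (p \<odot>\<^bsub>N\<^esub> a) 1 - Poly_Mapping.single a (Fract p 1)
        | p a. a \<in> carrier N}"

definition fract_tensor ::
    "('p::idom, 'v, 'z) module_scheme \<Rightarrow> ('p fract, ('v \<Rightarrow>\<^sub>0 'p fract) set) module" where
  "fract_tensor N = quotient_module (free_space (carrier N))
     (LinearCombinations.module.span class_ring (free_space (carrier N)) (tensor_relations N))"

text \<open>The rank of a subset \<open>S\<close> of a module \<open>N\<close> is the rank of the submodule it generates. The
  library's \<open>dim\<close> is meaningful for finite-dimensional spaces only; for \<open>W\<^sub>n\<close>, its quotients
  and their submodules \<open>fract_tensor\<close> has dimension at most \<open>n\<close>.\<close>

definition rank :: "('p::idom, 'v, 'z) module_scheme \<Rightarrow> 'v set \<Rightarrow> nat" where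
  "rank N S = vectorspace.dim class_ring
     (fract_tensor (N\<lparr>carrier := LinearCombinations.module.span class_ring N S\<rparr>))"

section \<open>Lie algebras\<close>

record ('k, 'v) lie_algebra = "('k, 'v) module" +
  bracket :: "'v \<Rightarrow> 'v \<Rightarrow> 'v"

definition lie_subalgebra :: "('k::field, 'v, 'z) lie_algebra_scheme \<Rightarrow> 'v set \<Rightarrow> bool" where
  "lie_subalgebra L S \<longleftrightarrow> LinearCombinations.submodule class_ring S L \<and>
     (\<forall>a\<in>S. \<forall>b\<in>S. bracket L a b \<in> S)"

text \<open>By antisymmetry of the bracket, one-sided closure suffices.\<close>

definition lie_ideal :: "('k::field, 'v, 'z) lie_algebra_scheme \<Rightarrow> 'v set \<Rightarrow> bool" where
  "lie_ideal L J \<longleftrightarrow> LinearCombinations.submodule class_ring J L \<and>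
     (\<forall>a\<in>carrier L. \<forall>b\<in>J. bracket L a b \<in> J)"

definition maximal_subalgebra :: "('k::field, 'v, 'z) lie_algebra_scheme \<Rightarrow> 'v set \<Rightarrow> bool" where
  "maximal_subalgebra L M \<longleftrightarrow> lie_subalgebra L M \<and> M \<noteq> carrier L \<and>
     (\<forall>S. lie_subalgebra L S \<and> S \<noteq> carrier L \<longrightarrow> \<not> M \<subset> S)"

definition quotient_lie ::
    "('k, 'v, 'z) lie_algebra_scheme \<Rightarrow> 'v set \<Rightarrow> ('k, 'v set) lie_algebra" where
  "quotient_lie L U = module.extend (quotient_module L U)
     (lie_algebra.fields (\<lambda>A B. \<Union>a\<in>A. \<Union>b\<in>B. U +>\<^bsub>L\<^esub> bracket L a b))"

section \<open>Derivations of polynomial rings\<close>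

text \<open>Polynomials over \<open>'k\<close> in the variables \<open>x\<^sub>i\<close>, \<open>i :: 'n\<close>, are finitely supported functions
  from exponent vectors to coefficients; multiplication is convolution. For a finite type \<open>'n\<close> there
  are \<open>n = CARD('n)\<close> variables.\<close>

type_synonym ('n, 'k) mpoly = "('n \<Rightarrow>\<^sub>0 nat) \<Rightarrow>\<^sub>0 'k"

abbreviation scalar :: "'k::field \<Rightarrow> ('n, 'k) mpoly" where
  "scalar c \<equiv> Poly_Mapping.single 0 c"

definition derivations :: "(('n, 'k::field) mpoly \<Rightarrow> ('n, 'k) mpoly) set" where
  "derivations = {D. (\<forall>f g. D (f + g) = D f + D g) \<and> (\<forall>c f. D (scalar c * f) = scalar c * D f) \<and>
     (\<forall>f g. D (f * g) = D f * g + f * D g)}"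

text \<open>\<open>W\<^sub>n\<close> as a module over the polynomial ring, and as a Lie algebra over \<open>'k\<close>.\<close>

definition W_module :: "(('n, 'k::field) mpoly, ('n, 'k) mpoly \<Rightarrow> ('n, 'k) mpoly) module" where
  "W_module = \<lparr>carrier = derivations, mult = undefined, one = undefined,
     zero = (\<lambda>f. 0), add = (\<lambda>D E f. D f + E f), smult = (\<lambda>p D f. p * D f)\<rparr>"

definition W_lie :: "('k::field, ('n, 'k) mpoly \<Rightarrow> ('n, 'k) mpoly) lie_algebra" where
  "W_lie = \<lparr>carrier = derivations, mult = undefined, one = undefined,
     zero = (\<lambda>f. 0), add = (\<lambda>D E f. D f + E f), smult = (\<lambda>c D f. scalar c * D f),
     bracket = (\<lambda>D E f. D (E f) - E (D f))\<rparr>"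

definition polynomial :: "(('n, 'k::field) mpoly \<Rightarrow> ('n, 'k) mpoly) set \<Rightarrow> bool" where
  "polynomial L \<longleftrightarrow> LinearCombinations.submodule class_ring L W_module"

definition polynomial_ideal ::
    "(('n, 'k::field) mpoly \<Rightarrow> ('n, 'k) mpoly) set \<Rightarrow> (('n, 'k) mpoly \<Rightarrow> ('n, 'k) mpoly) set \<Rightarrow> bool" where
  "polynomial_ideal M I \<longleftrightarrow> lie_ideal (W_lie\<lparr>carrier := M\<rparr>) I \<and> polynomial I"

definition maximal_polynomial_ideal ::
    "(('n, 'k::field) mpoly \<Rightarrow> ('n, 'k) mpoly) set \<Rightarrow> (('n, 'k) mpoly \<Rightarrow> ('n, 'k) mpoly) set \<Rightarrow> bool" where
  "maximal_polynomial_ideal M I \<longleftrightarrow> polynomial_ideal M I \<and>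
     (\<forall>I'. polynomial_ideal M I' \<and> I \<subseteq> I' \<longrightarrow> I' = I)"

definition ideal_times_W ::
    "('n, 'k::field) mpoly set \<Rightarrow> (('n, 'k) mpoly \<Rightarrow> ('n, 'k) mpoly) set" where
  "ideal_times_W I = {(\<lambda>f. \<Sum>i<m. h i * D i f) | (m::nat) h D.
     \<forall>i<m. h i \<in> I \<and> D i \<in> derivations}"

end

theory Submission
  imports "HOL-Analysis.Cartesian_Space" Defs
begin

text \<open>The rank of a module is the least size of a finite set whose span contains a nonzero multiple of
  every element, so it is subadditive under quotients, and a subset of \<open>W\<^sub>n\<close> has rank \<open>n\<close> iff its
  \<open>P\<^sub>n\<close>-span contains \<open>p W\<^sub>n\<close> for some \<open>p \<noteq> 0\<close>.

  If \<open>J\<close> is a nonzero ideal of \<open>M\<close> of rank below \<open>n\<close>, then \<open>M + P\<^sub>nJ\<close> is a subalgebra. Were it all of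
  \<open>W\<^sub>n\<close>, then \<open>P\<^sub>nJ\<close> would be an ideal of \<open>W\<^sub>n\<close>, and \<open>[D, gE] - g[D, E] = D(g)E\<close> would give
  \<open>D(g) W\<^sub>n \<subseteq> P\<^sub>nJ\<close>, that is rank \<open>n\<close>. Hence \<open>P\<^sub>nJ \<subseteq> M\<close> by maximality. The largest polynomial ideal of
  \<open>M\<close> is \<open>{D. P\<^sub>nD \<subseteq> M}\<close>; if it had rank \<open>n\<close>, the polynomials \<open>p\<close> with \<open>p W\<^sub>n\<close> inside it would form a
  nonzero ideal of \<open>P\<^sub>n\<close> stable under \<open>P\<^sub>nM = W\<^sub>n\<close>, hence containing \<open>1\<close>. A small ideal of the quotient
  lifts to an ideal of \<open>M\<close> of rank below \<open>n\<close>, whose \<open>P\<^sub>n\<close>-span must already lie in \<open>M\<^sub>0\<close>.\<close>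

section \<open>Quotient modules\<close>

locale module_quotient = Module.module R N for R (structure) and N (structure) +
  fixes U
  assumes submodule_U: "LinearCombinations.submodule R U N"
begin

lemma subset_U: "u \<in> U \<Longrightarrow> u \<in> carrier N"
  using submodule.subset[OF submodule_U] by blast

lemma uminus_U: "u \<in> U \<Longrightarrow> \<ominus>\<^bsub>N\<^esub> u \<in> U"
  using submodule.smult_closed[OF submodule_U, of "\<ominus>\<^bsub>R\<^esub> \<one>\<^bsub>R\<^esub>" u] subset_U[of u]
  by (simp add: smult_l_minus)

lemma abelian_subgroup_U: "abelian_subgroup U N"
proof (rule abelian_subgroupI3)
  show "additive_subgroup U N"
    using submodule.subset[OF submodule_U] submodule.m_closed[OF submodule_U]
      submodule.zero_closed[OF submodule_U] uminus_U
    by (intro additive_subgroup.intro subgroup.intro) (auto simp: a_inv_def[symmetric])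
qed (rule M.abelian_group_axioms)

sublocale sub: abelian_subgroup U N
  by (rule abelian_subgroup_U)

abbreviation "quot \<equiv> quotient_module N U"

lemma coset_eq_iff:
  assumes "a \<in> carrier N" "b \<in> carrier N"
  shows "U +>\<^bsub>N\<^esub> a = U +>\<^bsub>N\<^esub> b \<longleftrightarrow> a \<ominus>\<^bsub>N\<^esub> b \<in> U"
proof -
  have "a \<ominus>\<^bsub>N\<^esub> b \<in> U \<longleftrightarrow> a \<in> U +>\<^bsub>N\<^esub> b"
    using sub.a_rcos_module[OF assms(2,1)] by (simp add: a_minus_def)
  also have "\<dots> \<longleftrightarrow> U +>\<^bsub>N\<^esub> a = U +>\<^bsub>N\<^esub> b"
    using assms sub.a_rcos_self[of a] sub.a_repr_independence'[of a b] by auto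
  finally show ?thesis by blast
qed

lemma carrier_quot: "carrier quot = (\<lambda>a. U +>\<^bsub>N\<^esub> a) ` carrier N"
  by (auto simp: quotient_module_def A_RCOSETS_def')

lemma zero_quot: "\<zero>\<^bsub>quot\<^esub> = U +>\<^bsub>N\<^esub> \<zero>\<^bsub>N\<^esub>"
  using subset_U by (auto simp: quotient_module_def a_r_coset_def')

lemma add_quot:
  "a \<in> carrier N \<Longrightarrow> b \<in> carrier N \<Longrightarrow>
    (U +>\<^bsub>N\<^esub> a) \<oplus>\<^bsub>quot\<^esub> (U +>\<^bsub>N\<^esub> b) = U +>\<^bsub>N\<^esub> (a \<oplus>\<^bsub>N\<^esub> b)"
  by (simp add: quotient_module_def sub.a_rcos_sum)

text \<open>The product in \<open>quotient_module\<close> is a union over all representatives x of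
  the coset. Two representatives differ by some u in U, and r u stays in U, so all members of the
  union are the same coset.\<close>

lemma smult_quot:
  assumes r: "r \<in> carrier R" and a: "a \<in> carrier N"
  shows "r \<odot>\<^bsub>quot\<^esub> (U +>\<^bsub>N\<^esub> a) = U +>\<^bsub>N\<^esub> (r \<odot>\<^bsub>N\<^esub> a)"
proof -
  have "U +>\<^bsub>N\<^esub> (r \<odot>\<^bsub>N\<^esub> x) = U +>\<^bsub>N\<^esub> (r \<odot>\<^bsub>N\<^esub> a)" if "x \<in> U +>\<^bsub>N\<^esub> a" for x
  proof -
    from that obtain u where u: "u \<in> U" "x = u \<oplus>\<^bsub>N\<^esub> a"
      by (auto simp: a_r_coset_def')
    have "r \<odot>\<^bsub>N\<^esub> x = r \<odot>\<^bsub>N\<^esub> u \<oplus>\<^bsub>N\<^esub> r \<odot>\<^bsub>N\<^esub> a"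
      using u r a subset_U by (simp add: smult_r_distr)
    then have "r \<odot>\<^bsub>N\<^esub> x \<ominus>\<^bsub>N\<^esub> r \<odot>\<^bsub>N\<^esub> a = r \<odot>\<^bsub>N\<^esub> u"
      using u r a subset_U by (simp add: a_minus_def M.a_assoc M.r_neg)
    then show ?thesis
      using u r a subset_U submodule.smult_closed[OF submodule_U] by (simp add: coset_eq_iff)
  qed
  moreover have "U +>\<^bsub>N\<^esub> a \<noteq> {}"
    using sub.a_rcos_self[OF a] by auto
  ultimately show ?thesis
    by (simp add: quotient_module_def)
qed

lemma module_quot: "Module.module R quot"
proof (rule moduleI)
  show "abelian_group quot"
  proof (rule abelian_groupI)
    fix x assume "x \<in> carrier quot"
    then obtain a where a: "a \<in> carrier N" "x = U +>\<^bsub>N\<^esub> a" by (auto simp: carrier_quot)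
    have "(U +>\<^bsub>N\<^esub> (\<ominus>\<^bsub>N\<^esub> a)) \<oplus>\<^bsub>quot\<^esub> x = \<zero>\<^bsub>quot\<^esub>"
      using a by (simp add: add_quot zero_quot M.l_neg)
    then show "\<exists>y\<in>carrier quot. y \<oplus>\<^bsub>quot\<^esub> x = \<zero>\<^bsub>quot\<^esub>"
      using a by (auto simp: carrier_quot)
  qed (auto simp: carrier_quot add_quot zero_quot M.a_ac)
qed (auto simp: carrier_quot add_quot smult_quot R.cring_axioms
    smult_l_distr smult_r_distr smult_assoc1)

lemma coset_in_quot: "a \<in> carrier N \<Longrightarrow> U +>\<^bsub>N\<^esub> a \<in> carrier quot"
  by (auto simp: carrier_quot)

lemma submodule_preimage:
  assumes "LinearCombinations.submodule R T quot"
  shows "LinearCombinations.submodule R {a \<in> carrier N. U +>\<^bsub>N\<^esub> a \<in> T} N"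
  using submodule.m_closed[OF assms] submodule.zero_closed[OF assms] submodule.smult_closed[OF assms]
  by (intro submodule.intro module_axioms) (auto simp: add_quot[symmetric] smult_quot[symmetric] zero_quot)

lemma submodule_image:
  assumes "LinearCombinations.submodule R X N"
  shows "LinearCombinations.submodule R ((\<lambda>a. U +>\<^bsub>N\<^esub> a) ` X) quot"
proof (intro submodule.intro module_quot)
  have X: "X \<subseteq> carrier N" by (rule submodule.subset[OF assms])
  show "(+>\<^bsub>N\<^esub>) U ` X \<subseteq> carrier quot"
    using X by (auto simp: carrier_quot)
  show "\<zero>\<^bsub>quot\<^esub> \<in> (+>\<^bsub>N\<^esub>) U ` X"
    using submodule.zero_closed[OF assms] by (auto simp: zero_quot)
  fix v assume v: "v \<in> (+>\<^bsub>N\<^esub>) U ` X"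
  { fix w assume "w \<in> (+>\<^bsub>N\<^esub>) U ` X"
    then show "v \<oplus>\<^bsub>quot\<^esub> w \<in> (+>\<^bsub>N\<^esub>) U ` X"
      using v X submodule.m_closed[OF assms] by (auto simp: add_quot subset_iff) }
  { fix c assume "c \<in> carrier R"
    then show "c \<odot>\<^bsub>quot\<^esub> v \<in> (+>\<^bsub>N\<^esub>) U ` X"
      using v X submodule.smult_closed[OF assms] by (auto simp: smult_quot subset_iff) }
qed

abbreviation "qspan \<equiv> LinearCombinations.module.span R quot"

text \<open>Each inclusion is minimality of a span: images and preimages of submodules under the
  quotient map are submodules.\<close>

lemma span_image:
  assumes "A \<subseteq> carrier N"
  shows "qspan ((\<lambda>a. U +>\<^bsub>N\<^esub> a) ` A) = (\<lambda>a. U +>\<^bsub>N\<^esub> a) ` span A"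
proof
  note S = span_is_submodule[OF assms]
  have A: "(\<lambda>a. U +>\<^bsub>N\<^esub> a) ` A \<subseteq> carrier quot"
    using assms coset_in_quot by blast
  show "qspan ((\<lambda>a. U +>\<^bsub>N\<^esub> a) ` A) \<subseteq> (\<lambda>a. U +>\<^bsub>N\<^esub> a) ` span A"
    using in_own_span[OF assms] by (intro module.span_is_subset[OF module_quot _ submodule_image[OF S]]) blast
  have "span A \<subseteq> {a \<in> carrier N. U +>\<^bsub>N\<^esub> a \<in> qspan ((\<lambda>a. U +>\<^bsub>N\<^esub> a) ` A)}"
    using module.in_own_span[OF module_quot A] assms
    by (intro span_is_subset submodule_preimage module.span_is_submodule[OF module_quot A]) blast
  then show "(\<lambda>a. U +>\<^bsub>N\<^esub> a) ` span A \<subseteq> qspan ((\<lambda>a. U +>\<^bsub>N\<^esub> a) ` A)"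
    by blast
qed

end

section \<open>Rank\<close>

lemma lookup_map_times [simp]:
  fixes r :: "'a::mult_zero"
  shows "Poly_Mapping.lookup (Poly_Mapping.map ((*) r) \<phi>) a = r * Poly_Mapping.lookup \<phi> a"
  by (simp add: Poly_Mapping.map.rep_eq when_def)

text \<open>Keys are removed one at a time from a finite superset S of the support. The step asks
  for no freshness of a, because the properties proved with it survive adding any further
  term.\<close>

lemma poly_mapping_add_induct [consumes 1, case_names zero add]:
  assumes "Poly_Mapping.keys \<phi> \<subseteq> A" and "P 0"
    and "\<And>\<phi> a r. a \<in> A \<Longrightarrow> P \<phi> \<Longrightarrow> P (\<phi> + Poly_Mapping.single a (r::'b::comm_monoid_add))"
  shows "P \<phi>"
proof -
  have "P \<phi>" if "finite S" "S \<subseteq> A" "Poly_Mapping.keys \<phi> \<subseteq> S" for S \<phi>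
    using that
  proof (induction S arbitrary: \<phi>)
    case empty
    then show ?case using assms(2) by simp
  next
    case (insert a S)
    define \<psi> where "\<psi> = Poly_Mapping.update a 0 \<phi>"
    have "Poly_Mapping.keys \<psi> \<subseteq> S"
      using insert.prems by (auto simp: \<psi>_def keys_update)
    moreover have "\<phi> = \<psi> + Poly_Mapping.single a (Poly_Mapping.lookup \<phi> a)"
      by (rule poly_mapping_eqI) (auto simp: \<psi>_def lookup_add lookup_single lookup_update when_def)
    ultimately show ?case
      using insert.IH[of \<psi>] insert.prems assms(3) by (metis insert_subset)
  qed
  from this[OF finite_keys assms(1) order_refl] show ?thesis .
qed

lemma keys_map_subset:
  "f 0 = 0 \<Longrightarrow> Poly_Mapping.keys (Poly_Mapping.map f \<phi>) \<subseteq> Poly_Mapping.keys \<phi>"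
  by (auto simp: in_keys_iff Poly_Mapping.map.rep_eq when_def)

lemma Fract_1_hom:
  fixes p q :: "'p::idom"
  shows "Fract 0 (1::'p) = 0" "Fract (1::'p) 1 = 1" "Fract (p + q) 1 = Fract p 1 + Fract q 1"
    "Fract (p * q) 1 = Fract p 1 * Fract q 1" "Fract (- p) 1 = - Fract p 1"
    "Fract (p - q) 1 = Fract p 1 - Fract q 1"
  by (simp_all add: Zero_fract_def One_fract_def)

lemma Fract_lookup_single:
  "Fract (Poly_Mapping.lookup (Poly_Mapping.single a p) b) 1 = Poly_Mapping.lookup (Poly_Mapping.single a (Fract p 1)) b"
  by (simp add: lookup_single when_def Fract_1_hom)

lemma keys_add_subset:
  "Poly_Mapping.keys \<phi> \<subseteq> A \<Longrightarrow> Poly_Mapping.keys \<psi> \<subseteq> A \<Longrightarrow> Poly_Mapping.keys (\<phi> + \<psi>) \<subseteq> A"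
  using Poly_Mapping.keys_add[of \<phi> \<psi>] by blast

lemma keys_diff_subset:
  "Poly_Mapping.keys \<phi> \<subseteq> A \<Longrightarrow> Poly_Mapping.keys \<psi> \<subseteq> A \<Longrightarrow> Poly_Mapping.keys (\<phi> - \<psi>) \<subseteq> A"
  using Poly_Mapping.keys_diff[of \<phi> \<psi>] by blast

context
  fixes A :: "'v set"
begin

lemma free_space_simps [simp]:
  "carrier (free_space A) = {\<phi>. Poly_Mapping.keys \<phi> \<subseteq> A}"
  "\<zero>\<^bsub>free_space A\<^esub> = 0"
  "\<phi> \<oplus>\<^bsub>free_space A\<^esub> \<psi> = \<phi> + \<psi>"
  "r \<odot>\<^bsub>free_space A\<^esub> \<phi> = Poly_Mapping.map ((*) r) \<phi>"
  by (simp_all add: free_space_def)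

lemma module_free_space: "module class_ring (free_space A :: ('f::field, 'v \<Rightarrow>\<^sub>0 'f) module)"
proof (rule moduleI)
  have keys: "Poly_Mapping.keys (Poly_Mapping.map ((*) r) \<phi>) \<subseteq> Poly_Mapping.keys \<phi>" for r :: 'f and \<phi> :: "'v \<Rightarrow>\<^sub>0 'f"
    by (auto simp: in_keys_iff)
  show "abelian_group (free_space A :: ('f, 'v \<Rightarrow>\<^sub>0 'f) module)"
  proof (rule abelian_groupI)
    fix \<phi> :: "'v \<Rightarrow>\<^sub>0 'f" assume "\<phi> \<in> carrier (free_space A)"
    then show "\<exists>\<psi>\<in>carrier (free_space A). \<psi> \<oplus>\<^bsub>free_space A\<^esub> \<phi> = \<zero>\<^bsub>free_space A\<^esub>"
      by (intro bexI[of _ "- \<phi>"]) auto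
  qed (simp_all add: add_ac keys_add_subset)
  fix r :: 'f and \<phi> :: "'v \<Rightarrow>\<^sub>0 'f" assume "\<phi> \<in> carrier (free_space A)"
  then show "r \<odot>\<^bsub>free_space A\<^esub> \<phi> \<in> carrier (free_space A)"
    using keys[of r \<phi>] by auto
qed (simp_all add: poly_mapping_eq_iff fun_eq_iff lookup_add algebra_simps class_cring.cring_axioms)

end

lemma a_minus_free_space:
  fixes \<phi> \<psi> :: "'v \<Rightarrow>\<^sub>0 'f::field"
  assumes "\<phi> \<in> carrier (free_space A)" "\<psi> \<in> carrier (free_space A)"
  shows "\<phi> \<ominus>\<^bsub>free_space A\<^esub> \<psi> = \<phi> - \<psi>"
proof -
  interpret F: Module.module class_ring "free_space A :: ('f, 'v \<Rightarrow>\<^sub>0 'f) module"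
    by (rule module_free_space)
  have "\<ominus>\<^bsub>free_space A\<^esub> \<psi> = - \<psi>"
    using assms by (intro F.minus_equality) auto
  then show ?thesis by (simp add: a_minus_def)
qed

section \<open>The space \<open>fract_tensor N\<close> as the quotient F / K, with
  \<open>sgl a\<close> standing for 1 \<otimes> a\<close>

locale fract_extension = Module.module class_ring N
  for N :: "('p::idom, 'v, 'z) module_scheme" (structure)
begin

abbreviation "F \<equiv> free_space (carrier N) :: ('p fract, 'v \<Rightarrow>\<^sub>0 'p fract) module"
abbreviation "K \<equiv> LinearCombinations.module.span class_ring F (tensor_relations N)"
abbreviation "V \<equiv> fract_tensor N"
abbreviation "sgl a \<equiv> Poly_Mapping.single a (1::'p fract)"

sublocale F: Module.module class_ring F
  by (rule module_free_space)

lemma sgl_carrier [simp]: "a \<in> carrier N \<Longrightarrow> Poly_Mapping.single a r \<in> carrier F"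
  by simp

lemma relations_carrier: "tensor_relations N \<subseteq> carrier F"
proof
  fix \<phi> assume "\<phi> \<in> tensor_relations N"
  then consider a b where "a \<in> carrier N" "b \<in> carrier N" "\<phi> = sgl (a \<oplus> b) - sgl a - sgl b"
    | p a where "a \<in> carrier N" "\<phi> = sgl (p \<odot> a) - Poly_Mapping.single a (Fract p 1)"
    unfolding tensor_relations_def by blast
  then show "\<phi> \<in> carrier F"
    by cases (simp_all add: keys_diff_subset)
qed

sublocale Q: module_quotient class_ring F K
  by (rule module_quotient.intro[OF module_free_space
        module_quotient_axioms.intro[OF F.span_is_submodule[OF relations_carrier]]])

lemma V_eq: "V = Q.quot"
  by (rule fract_tensor_def)

lemma vectorspace_V: "vectorspace class_ring V"
  unfolding V_eq by (rule vectorspace.intro[OF Q.module_quot class_field])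

sublocale V: vectorspace class_ring V
  by (rule vectorspace_V)

lemma K_add: "a \<in> carrier N \<Longrightarrow> b \<in> carrier N \<Longrightarrow> sgl (a \<oplus> b) - sgl a - sgl b \<in> K"
  using F.in_own_span[OF relations_carrier] unfolding tensor_relations_def by blast

lemma K_smult: "a \<in> carrier N \<Longrightarrow> sgl (p \<odot> a) - Poly_Mapping.single a (Fract p 1) \<in> K"
  using F.in_own_span[OF relations_carrier] unfolding tensor_relations_def by blast

abbreviation "scl r \<equiv> Poly_Mapping.map ((*) (r::'p fract)) :: _ \<Rightarrow> ('v \<Rightarrow>\<^sub>0 'p fract)"

lemma scl_add: "scl r (\<phi> + \<psi>) = scl r \<phi> + scl r \<psi>"
  and scl_diff: "scl r (\<phi> - \<psi>) = scl r \<phi> - scl r \<psi>"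
  and scl_scl: "scl r (scl s \<phi>) = scl (r * s) \<phi>"
  and scl_one: "scl 1 \<phi> = \<phi>"
  and scl_single: "scl r (Poly_Mapping.single a s) = Poly_Mapping.single a (r * s)"
  and scl_uminus_one: "scl (-1) \<phi> = - \<phi>"
  by (auto simp: poly_mapping_eq_iff fun_eq_iff lookup_add lookup_minus algebra_simps lookup_single when_def)

lemma submodule_F_closed:
  assumes X: "submodule class_ring X F"
  shows "0 \<in> X" and "\<phi> \<in> X \<Longrightarrow> \<psi> \<in> X \<Longrightarrow> \<phi> + \<psi> \<in> X" and "\<phi> \<in> X \<Longrightarrow> scl r \<phi> \<in> X"
    and "\<phi> \<in> X \<Longrightarrow> \<psi> \<in> X \<Longrightarrow> \<phi> - \<psi> \<in> X"
proof -
  show *: "0 \<in> X" "\<And>\<phi> \<psi>. \<phi> \<in> X \<Longrightarrow> \<psi> \<in> X \<Longrightarrow> \<phi> + \<psi> \<in> X" "\<And>\<phi> r. \<phi> \<in> X \<Longrightarrow> scl r \<phi> \<in> X"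
    using submodule.zero_closed[OF X] submodule.m_closed[OF X] submodule.smult_closed[OF X] by simp_all
  show "\<phi> \<in> X \<Longrightarrow> \<psi> \<in> X \<Longrightarrow> \<phi> - \<psi> \<in> X"
    using *(2)[of \<phi> "- \<psi>"] *(3)[of \<psi> "-1"] by (simp add: scl_uminus_one)
qed

lemmas K_closed = submodule_F_closed[OF Q.submodule_U]

lemma K_smult_scl:
  "a \<in> carrier N \<Longrightarrow> sgl (p \<odot> a) - scl (Fract p 1) (sgl a) \<in> K"
  using K_smult[of a p] by (simp add: scl_single)

text \<open>Let Y be the set of all a with 1 \<otimes> a in X. As X contains the relations, Y is a
  submodule of N and so contains \<open>span A\<close>. If p a lies in that span, then p \<otimes> a
  is in X, and scaling by r/p gives every r \<otimes> a; these generate F.\<close>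

lemma submodule_F_eq_carrier:
  assumes X: "submodule class_ring X F" and KX: "K \<subseteq> X" and A: "A \<subseteq> carrier N" "sgl ` A \<subseteq> X"
    and gen: "\<And>a. a \<in> carrier N \<Longrightarrow> \<exists>p. p \<noteq> 0 \<and> p \<odot> a \<in> span A"
  shows "X = carrier F"
proof -
  note Xc = submodule_F_closed[OF X]
  define Y where "Y = {a \<in> carrier N. sgl a \<in> X}"
  have sgl_smult_iff: "sgl (p \<odot> a) \<in> X \<longleftrightarrow> scl (Fract p 1) (sgl a) \<in> X" if "a \<in> carrier N" for p a
    using K_smult_scl[OF that, of p] KX Xc(2)[of "sgl (p \<odot> a) - scl (Fract p 1) (sgl a)" "scl (Fract p 1) (sgl a)"]
      Xc(4)[of "sgl (p \<odot> a)" "sgl (p \<odot> a) - scl (Fract p 1) (sgl a)"] by auto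
  have smultY: "p \<odot> a \<in> Y" if "a \<in> Y" for p a
    using that sgl_smult_iff[of a p] Xc(3)[of "sgl a" "Fract p 1"] by (auto simp: Y_def)
  have "submodule class_ring Y N"
  proof (intro submodule.intro module_axioms)
    fix a b assume ab: "a \<in> Y" "b \<in> Y"
    have "sgl (a \<oplus> b) - sgl a - sgl b \<in> X"
      using ab K_add[of a b] KX by (auto simp: Y_def)
    from Xc(2)[OF this Xc(2)[of "sgl a" "sgl b"]] show "a \<oplus> b \<in> Y"
      using ab by (auto simp: Y_def algebra_simps)
  next
    \<comment> \<open>\<open>sgl \<zero>\<close> is a nonzero element of F; the scalar relation for
      \<open>0 \<odot> \<zero>\<close> is what brings it into X.\<close>
    have "sgl (0 \<odot> \<zero>) \<in> X"
      using sgl_smult_iff[of \<zero> 0] Xc(1) by (simp add: scl_single Zero_fract_def[symmetric])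
    then show "\<zero> \<in> Y"
      using smult_l_null[of \<zero>] by (simp add: Y_def)
  qed (auto simp: smultY, simp add: Y_def)
  then have spanY: "span A \<subseteq> Y"
    by (intro span_is_subset) (use A in \<open>auto simp: Y_def\<close>)
  have sgl_X: "Poly_Mapping.single a r \<in> X" if a: "a \<in> carrier N" for a r
  proof -
    from gen[OF a] obtain p where p: "p \<noteq> 0" "p \<odot> a \<in> span A" by blast
    then have "scl (Fract p 1) (sgl a) \<in> X"
      using spanY sgl_smult_iff[OF a] by (auto simp: Y_def)
    moreover have "r * Fract 1 p * Fract p 1 = r"
      using p by (simp add: mult.assoc eq_fract One_fract_def)
    ultimately show ?thesis
      using Xc(3)[of "scl (Fract p 1) (sgl a)" "r * Fract 1 p"]
      by (simp only: scl_scl scl_single mult_1_right)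
  qed
  have "\<phi> \<in> X" if "Poly_Mapping.keys \<phi> \<subseteq> carrier N" for \<phi>
    using that by (induction rule: poly_mapping_add_induct) (auto intro: Xc sgl_X)
  then show ?thesis
    using submodule.subset[OF X] by auto
qed

text \<open>Describes generating sets of V inside N: for such A the vectors 1 \<otimes> a generate
  V, and a basis of V yields such an A of at most the same size. Ranks can then be compared without
  the tensor product.\<close>

definition rationally_spans :: "'v set \<Rightarrow> bool" where
  "rationally_spans A \<longleftrightarrow> finite A \<and> A \<subseteq> carrier N \<and> (\<forall>a\<in>carrier N. \<exists>p. p \<noteq> 0 \<and> p \<odot> a \<in> span A)"

text \<open>The preimage in F of the span of the classes is a submodule containing K and every
  \<open>sgl a\<close> with a in A, so \<open>submodule_F_eq_carrier\<close> makes it all of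
  F.\<close>

lemma gen_set_if_rationally_spans:
  assumes A: "rationally_spans A"
  shows "V.gen_set ((\<lambda>a. K +>\<^bsub>F\<^esub> sgl a) ` A)"
proof -
  let ?B = "(\<lambda>a. K +>\<^bsub>F\<^esub> sgl a) ` A"
  have AN: "A \<subseteq> carrier N" using A by (simp add: rationally_spans_def)
  have B: "?B \<subseteq> carrier V"
    unfolding V_eq using AN by (blast intro: Q.coset_in_quot sgl_carrier)
  let ?T = "V.span ?B"
  have T: "submodule class_ring ?T V"
    by (rule V.span_is_submodule[OF B])
  let ?X = "{\<phi> \<in> carrier F. K +>\<^bsub>F\<^esub> \<phi> \<in> ?T}"
  have X: "submodule class_ring ?X F"
    by (rule Q.submodule_preimage[OF T[unfolded V_eq], folded V_eq])
  have "?X = carrier F"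
  proof (rule submodule_F_eq_carrier[OF X _ AN])
    show "K \<subseteq> ?X"
    proof
      fix k assume k: "k \<in> K"
      have "K +>\<^bsub>F\<^esub> k = \<zero>\<^bsub>V\<^esub>"
        unfolding V_eq Q.zero_quot using k Q.subset_U[OF k]
        by (subst Q.coset_eq_iff) (simp_all add: a_minus_free_space)
      then show "k \<in> ?X"
        using Q.subset_U[OF k] submodule.zero_closed[OF T] by simp
    qed
    show "sgl ` A \<subseteq> ?X"
      using AN V.in_own_span[OF B] by auto
    show "\<And>a. a \<in> carrier N \<Longrightarrow> \<exists>p. p \<noteq> 0 \<and> p \<odot> a \<in> span A"
      using A by (simp add: rationally_spans_def)
  qed
  then have "carrier V \<subseteq> ?T"
    unfolding V_eq Q.carrier_quot by blast
  then show ?thesis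
    using V.span_is_subset2[OF B] by blast
qed

lemma dim_le_card:
  assumes A: "rationally_spans A"
  shows "V.fin_dim" "V.dim \<le> card A"
proof -
  let ?B = "(\<lambda>a. K +>\<^bsub>F\<^esub> sgl a) ` A"
  have B: "finite ?B" "?B \<subseteq> carrier V" 
    using A Q.coset_in_quot sgl_carrier unfolding V_eq rationally_spans_def by blast+
  show "V.fin_dim"
    unfolding V.fin_dim_def using B gen_set_if_rationally_spans[OF A] by blast
  have "V.dim \<le> card ?B"
    using B gen_set_if_rationally_spans[OF A] by (intro V.gen_ge_dim)
  also have "\<dots> \<le> card A"
    using A by (simp add: rationally_spans_def card_image_le)
  finally show "V.dim \<le> card A" .
qed

section \<open>Evaluation of formal combinations and detection of torsion\<close>

lemma class_smult:
  assumes "a \<in> carrier N"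
  shows "p \<odot> a \<in> carrier N" "0 \<odot> a = \<zero>" "1 \<odot> a = a" "(p + q) \<odot> a = p \<odot> a \<oplus> q \<odot> a"
    "(p * q) \<odot> a = p \<odot> (q \<odot> a)" "(- p) \<odot> a = \<ominus> (p \<odot> a)"
  using assms smult_closed[of p a] smult_l_null[of a] smult_one[of a] smult_l_distr[of p q a]
    smult_assoc1[of p q a] smult_l_minus[of p a] by (simp_all add: class_ring_simps)

definition eval_sum :: "('v \<Rightarrow>\<^sub>0 'p) \<Rightarrow> 'v" where
  "eval_sum h = finsum N (\<lambda>a. Poly_Mapping.lookup h a \<odot> a) (Poly_Mapping.keys h)"

lemma eval_sum_superset:
  assumes "finite S" "Poly_Mapping.keys h \<subseteq> S" "S \<subseteq> carrier N"
  shows "eval_sum h = finsum N (\<lambda>a. Poly_Mapping.lookup h a \<odot> a) S"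
  unfolding eval_sum_def using assms
  by (intro M.add.finprod_mono_neutral_cong_left) (auto simp: in_keys_iff class_smult subset_iff)

lemma eval_sum_zero: "eval_sum 0 = \<zero>"
  by (simp add: eval_sum_def)

lemma eval_sum_single: "a \<in> carrier N \<Longrightarrow> eval_sum (Poly_Mapping.single a p) = p \<odot> a"
  by (subst eval_sum_superset[of "{a}"]) auto

lemma eval_sum_add:
  assumes "Poly_Mapping.keys g \<subseteq> carrier N" "Poly_Mapping.keys h \<subseteq> carrier N"
  shows "eval_sum (g + h) = eval_sum g \<oplus> eval_sum h"
proof -
  let ?S = "Poly_Mapping.keys g \<union> Poly_Mapping.keys h"
  have S: "finite ?S" "?S \<subseteq> carrier N" using assms by auto
  have "eval_sum (g + h) = finsum N (\<lambda>a. Poly_Mapping.lookup (g + h) a \<odot> a) ?S"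
    by (rule eval_sum_superset) (use S Poly_Mapping.keys_add[of g h] in auto)
  also have "\<dots> = finsum N (\<lambda>a. Poly_Mapping.lookup g a \<odot> a \<oplus> Poly_Mapping.lookup h a \<odot> a) ?S"
    by (rule M.finsum_cong') (use S in \<open>auto simp: lookup_add class_smult subset_iff simp del: Un_iff\<close>)
  also have "\<dots> = eval_sum g \<oplus> eval_sum h"
    using S eval_sum_superset[of ?S g] eval_sum_superset[of ?S h]
    by (subst M.finsum_addf) (auto simp: class_smult subset_iff)
  finally show ?thesis .
qed

lemma eval_sum_smult:
  assumes "Poly_Mapping.keys h \<subseteq> carrier N"
  shows "eval_sum (Poly_Mapping.map ((*) p) h) = p \<odot> eval_sum h"
proof -
  have "eval_sum (Poly_Mapping.map ((*) p) h)
      = finsum N (\<lambda>a. p \<odot> (Poly_Mapping.lookup h a \<odot> a)) (Poly_Mapping.keys h)"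
    using assms keys_map_subset[of "(*) p" h]
    by (subst eval_sum_superset[of "Poly_Mapping.keys h"])
      (auto intro!: M.finsum_cong' simp: class_smult subset_iff)
  also have "\<dots> = p \<odot> eval_sum h"
    unfolding eval_sum_def using assms by (subst finsum_smult_ldistr) auto
  finally show ?thesis .
qed

abbreviation "fracs h \<equiv> Poly_Mapping.map (\<lambda>p. Fract p (1::'p)) (h :: 'v \<Rightarrow>\<^sub>0 'p)"

lemma lookup_fracs: "Poly_Mapping.lookup (fracs h) a = Fract (Poly_Mapping.lookup h a) 1"
  by (simp add: Poly_Mapping.map.rep_eq when_def Zero_fract_def)

text \<open>Sending \<open>r \<otimes> a\<close> to \<open>r a\<close> is not defined on \<open>F\<close>, but its vanishing after clearing denominators
  is. Since this holds on the relations, \<open>1 \<otimes> a = 0\<close> only for torsion elements \<open>a\<close>.\<close>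

definition null_combinations :: "('v \<Rightarrow>\<^sub>0 'p fract) set" where
  "null_combinations = {\<phi>. \<exists>p h. p \<noteq> 0 \<and> Poly_Mapping.keys \<phi> \<subseteq> carrier N \<and>
     Poly_Mapping.keys h \<subseteq> carrier N \<and> eval_sum h = \<zero> \<and> scl (Fract p 1) \<phi> = fracs h}"

lemma null_combinationsI:
  assumes "p \<noteq> 0" "Poly_Mapping.keys \<phi> \<subseteq> carrier N" "Poly_Mapping.keys h \<subseteq> carrier N"
    "eval_sum h = \<zero>" "\<And>a. Fract p 1 * Poly_Mapping.lookup \<phi> a = Fract (Poly_Mapping.lookup h a) 1"
  shows "\<phi> \<in> null_combinations"
  unfolding null_combinations_def using assms
  by (auto intro!: exI[of _ p] exI[of _ h] simp: poly_mapping_eq_iff fun_eq_iff lookup_fracs)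

lemma null_combinationsE:
  assumes "\<phi> \<in> null_combinations"
  obtains p h where "p \<noteq> 0" "Poly_Mapping.keys \<phi> \<subseteq> carrier N" "Poly_Mapping.keys h \<subseteq> carrier N"
    "eval_sum h = \<zero>" "\<And>a. Fract p 1 * Poly_Mapping.lookup \<phi> a = Fract (Poly_Mapping.lookup h a) 1"
proof -
  from assms obtain p h where *: "p \<noteq> 0" "Poly_Mapping.keys \<phi> \<subseteq> carrier N" "Poly_Mapping.keys h \<subseteq> carrier N"
    "eval_sum h = \<zero>" "scl (Fract p 1) \<phi> = fracs h"
    unfolding null_combinations_def by blast
  show thesis
    using arg_cong[OF *(5), of "\<lambda>\<psi>. Poly_Mapping.lookup \<psi> a" for a]
    by (intro that[OF *(1-4)]) (simp add: lookup_fracs)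
qed

text \<open>Sums are written over the common denominator p q with numerator q g + p h, and scaling
  by s/t uses the denominator t p with numerator s h. \<open>eval_sum\<close> is linear over the
  polynomial ring, so these numerators still evaluate to zero.\<close>

lemma submodule_null_combinations: "submodule class_ring null_combinations F"
proof (intro submodule.intro module_free_space)
  show "null_combinations \<subseteq> carrier F"
    by (auto simp: null_combinations_def)
  show "\<zero>\<^bsub>F\<^esub> \<in> null_combinations"
    by (rule null_combinationsI[of 1 _ 0]) (simp_all add: eval_sum_zero Zero_fract_def)
next
  fix \<phi> \<psi> assume "\<phi> \<in> null_combinations" "\<psi> \<in> null_combinations"
  then obtain p g q h where
    g: "p \<noteq> 0" "Poly_Mapping.keys \<phi> \<subseteq> carrier N" "Poly_Mapping.keys g \<subseteq> carrier N"
      "eval_sum g = \<zero>" "\<And>a. Fract p 1 * Poly_Mapping.lookup \<phi> a = Fract (Poly_Mapping.lookup g a) 1" and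
    h: "q \<noteq> 0" "Poly_Mapping.keys \<psi> \<subseteq> carrier N" "Poly_Mapping.keys h \<subseteq> carrier N"
      "eval_sum h = \<zero>" "\<And>a. Fract q 1 * Poly_Mapping.lookup \<psi> a = Fract (Poly_Mapping.lookup h a) 1"
    by (metis null_combinationsE)
  let ?g = "Poly_Mapping.map ((*) q) g" and ?h = "Poly_Mapping.map ((*) p) h"
  have k: "Poly_Mapping.keys ?g \<subseteq> carrier N" "Poly_Mapping.keys ?h \<subseteq> carrier N"
    using g(3) h(3) keys_map_subset[of "(*) q" g] keys_map_subset[of "(*) p" h] by auto
  have "\<phi> + \<psi> \<in> null_combinations"
  proof (rule null_combinationsI[of "p * q" _ "?g + ?h"])
    fix a
    have "Fract (p * q) 1 * (Poly_Mapping.lookup \<phi> a + Poly_Mapping.lookup \<psi> a)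
      = Fract q 1 * (Fract p 1 * Poly_Mapping.lookup \<phi> a) + Fract p 1 * (Fract q 1 * Poly_Mapping.lookup \<psi> a)"
      unfolding Fract_1_hom by (simp only: algebra_simps)
    then show "Fract (p * q) 1 * Poly_Mapping.lookup (\<phi> + \<psi>) a = Fract (Poly_Mapping.lookup (?g + ?h) a) 1"
      by (simp add: g(5) h(5) lookup_add)
  qed (use g h k in \<open>simp_all add: keys_add_subset eval_sum_add eval_sum_smult\<close>)
  then show "\<phi> \<oplus>\<^bsub>F\<^esub> \<psi> \<in> null_combinations" by simp
next
  fix r :: "'p fract" and \<phi> assume "\<phi> \<in> null_combinations"
  then obtain p h where
    h: "p \<noteq> 0" "Poly_Mapping.keys \<phi> \<subseteq> carrier N" "Poly_Mapping.keys h \<subseteq> carrier N"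
      "eval_sum h = \<zero>" "\<And>a. Fract p 1 * Poly_Mapping.lookup \<phi> a = Fract (Poly_Mapping.lookup h a) 1"
    by (metis null_combinationsE)
  obtain s t where r: "r = Fract s t" "t \<noteq> 0" by (cases r) auto
  have "scl r \<phi> \<in> null_combinations"
  proof (rule null_combinationsI[of "t * p" _ "Poly_Mapping.map ((*) s) h"])
    fix a
    have "Fract (t * p) 1 * (r * Poly_Mapping.lookup \<phi> a)
        = (Fract t 1 * r) * (Fract p 1 * Poly_Mapping.lookup \<phi> a)"
      unfolding Fract_1_hom by (simp only: mult_ac)
    also have "Fract t 1 * r = Fract s 1"
      using r by (simp add: eq_fract)
    finally show "Fract (t * p) 1 * Poly_Mapping.lookup (scl r \<phi>) a
        = Fract (Poly_Mapping.lookup (Poly_Mapping.map ((*) s) h) a) 1"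
      by (simp add: h(5))
  qed (use h r keys_map_subset[of "(*) r" \<phi>] keys_map_subset[of "(*) s" h] in
      \<open>auto simp: eval_sum_smult\<close>)
  then show "r \<odot>\<^bsub>F\<^esub> \<phi> \<in> null_combinations" by simp
qed

text \<open>Both kinds of relation already have coefficients in the base domain, so the denominator
  1 serves, and the relation itself is the numerator.\<close>

lemma relations_null: "tensor_relations N \<subseteq> null_combinations"
proof
  fix \<phi> assume *: "\<phi> \<in> tensor_relations N"
  then have \<phi>: "Poly_Mapping.keys \<phi> \<subseteq> carrier N" using relations_carrier by auto
  have neg: "Poly_Mapping.single a (-1) = - Poly_Mapping.single a 1" for a :: 'v
    by (simp add: single_uminus)
  from * consider a b where "a \<in> carrier N" "b \<in> carrier N" "\<phi> = sgl (a \<oplus> b) - sgl a - sgl b"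
    | p a where "a \<in> carrier N" "\<phi> = sgl (p \<odot> a) - Poly_Mapping.single a (Fract p 1)"
    unfolding tensor_relations_def by blast
  then show "\<phi> \<in> null_combinations"
  proof cases
    case (1 a b)
    let ?h = "Poly_Mapping.single (a \<oplus> b) 1 + (Poly_Mapping.single a (-1) + Poly_Mapping.single b (-1)) :: 'v \<Rightarrow>\<^sub>0 'p"
    have "eval_sum ?h = (a \<oplus> b) \<oplus> ((\<ominus> a) \<oplus> (\<ominus> b))"
      using 1
      by (simp add: eval_sum_add eval_sum_single keys_add_subset class_smult)
    also have "\<dots> = \<zero>"
      using 1 by (simp add: M.minus_add[symmetric] M.r_neg)
    finally show ?thesis
      using 1 \<phi>
      by (intro null_combinationsI[of 1 _ ?h])
        (simp_all add: keys_add_subset keys_diff_subset lookup_add lookup_minus lookup_uminus Fract_1_hom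
          Fract_lookup_single single_uminus del: add_fract diff_fract)
  next
    case (2 p a)
    let ?h = "Poly_Mapping.single (p \<odot> a) 1 + Poly_Mapping.single a (-p) :: 'v \<Rightarrow>\<^sub>0 'p"
    have "eval_sum ?h = p \<odot> a \<oplus> (\<ominus> (p \<odot> a))"
      using 2
      by (simp add: eval_sum_add eval_sum_single keys_add_subset class_smult)
    also have "\<dots> = \<zero>"
      using 2 by (simp add: M.r_neg)
    finally show ?thesis
      using 2 \<phi>
      by (intro null_combinationsI[of 1 _ ?h])
        (simp_all add: keys_add_subset keys_diff_subset lookup_add lookup_minus lookup_uminus Fract_1_hom
          Fract_lookup_single single_uminus del: add_fract diff_fract)
  qed
qed

text \<open>K lies in \<open>null_combinations\<close>, since the relations do. Comparing
  coefficients, a numerator of \<open>sgl a\<close> over the denominator p can only be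
  \<open>Poly_Mapping.single a p\<close>, and its vanishing evaluation is p a.\<close>

lemma torsion_if_single_in_K:
  assumes a: "a \<in> carrier N" and K: "sgl a \<in> K"
  obtains p where "p \<noteq> 0" "p \<odot> a = \<zero>"
proof -
  have "sgl a \<in> null_combinations"
    using F.span_is_subset[OF relations_null submodule_null_combinations] K by blast
  then obtain p h where h: "p \<noteq> 0" "eval_sum h = \<zero>"
    "\<And>b. Fract p 1 * Poly_Mapping.lookup (sgl a) b = Fract (Poly_Mapping.lookup h b) 1"
    by (metis null_combinationsE)
  have "Poly_Mapping.lookup h b = (if b = a then p else 0)" for b
    using h(3)[of b] by (auto simp: lookup_single when_def eq_fract Zero_fract_def split: if_splits)
  then have "h = Poly_Mapping.single a p"
    by (auto simp: poly_mapping_eq_iff fun_eq_iff lookup_single when_def)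
  then show thesis
    using that h a by (simp add: eval_sum_single)
qed

text \<open>The tensors that are congruent modulo K to (1/q) \<otimes> c with a single c in S. For a
  submodule S this is the preimage in F of the subspace of V generated by the 1 \<otimes> c with c
  in S.\<close>

definition fractions :: "'v set \<Rightarrow> ('v \<Rightarrow>\<^sub>0 'p fract) set" where
  "fractions S = {\<phi> \<in> carrier F. \<exists>q c. q \<noteq> 0 \<and> c \<in> S \<and> scl (Fract q 1) \<phi> - sgl c \<in> K}"

lemma fractions_closed:
  assumes S: "submodule class_ring S N"
  shows "submodule class_ring (fractions S) F" "K \<subseteq> fractions S"
    "a \<in> S \<Longrightarrow> Poly_Mapping.single a r \<in> fractions S"
proof -
  have SN: "S \<subseteq> carrier N" by (rule submodule.subset[OF S])
  have S_smult: "p \<odot> c \<in> S" if "c \<in> S" for p c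
    using submodule.smult_closed[OF S, of p c] that by simp
  have single: "Poly_Mapping.single a r \<in> fractions S" if a: "a \<in> S" for a r
  proof -
    obtain s t where r: "r = Fract s t" "t \<noteq> 0" by (cases r) auto
    have "Fract t 1 * r = Fract s 1"
      using r by (simp add: eq_fract)
    then have "scl (Fract t 1) (Poly_Mapping.single a r) = Poly_Mapping.single a (Fract s 1)"
      by (simp only: scl_single)
    moreover have "Poly_Mapping.single a (Fract s 1) - sgl (s \<odot> a) \<in> K"
      using K_closed(4)[OF K_closed(1) K_smult[of a s]] a SN by auto
    ultimately have "scl (Fract t 1) (Poly_Mapping.single a r) - sgl (s \<odot> a) \<in> K"
      by (simp only:)
    then show ?thesis
      using r(2) S_smult[OF a, of s] sgl_carrier[OF subsetD[OF SN a], of r]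
      unfolding fractions_def by blast
  qed
  then show "a \<in> S \<Longrightarrow> Poly_Mapping.single a r \<in> fractions S" .
  \<comment> \<open>The additivity relation for \<open>\<zero> \<oplus> \<zero>\<close> is the
    negative of \<open>sgl \<zero>\<close>.\<close>
  have zero: "sgl \<zero> \<in> K"
    using K_closed(3)[OF K_add[of \<zero> \<zero>], of "-1"] by (simp add: scl_uminus_one)
  have z0: "\<zero> \<in> S" using submodule.zero_closed[OF S] by simp
  show "K \<subseteq> fractions S"
  proof
    fix k assume k: "k \<in> K"
    have "scl (Fract 1 1) k - sgl \<zero> \<in> K"
      using K_closed(4)[OF k zero] by (simp add: Fract_1_hom scl_one)
    then show "k \<in> fractions S"
      using Q.subset_U[OF k] z0 by (auto simp: fractions_def intro!: exI[of _ 1] exI[of _ \<zero>])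
  qed
  then have 0: "0 \<in> fractions S" using K_closed(1) by blast
  show "submodule class_ring (fractions S) F"
  proof (intro submodule.intro module_free_space)
    show "fractions S \<subseteq> carrier F" by (auto simp: fractions_def)
    show "\<zero>\<^bsub>F\<^esub> \<in> fractions S" using 0 by simp
  next
    fix \<phi> \<psi> assume "\<phi> \<in> fractions S" "\<psi> \<in> fractions S"
    then obtain p c q d where
      c: "\<phi> \<in> carrier F" "p \<noteq> 0" "c \<in> S" "scl (Fract p 1) \<phi> - sgl c \<in> K" and
      d: "\<psi> \<in> carrier F" "q \<noteq> 0" "d \<in> S" "scl (Fract q 1) \<psi> - sgl d \<in> K"
      unfolding fractions_def by blast
    \<comment> \<open>The numerator of c/p + d/q over the common denominator p q.\<close>
    let ?e = "q \<odot> c \<oplus> p \<odot> d"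
    have e: "q \<odot> c \<in> S" "p \<odot> d \<in> S" "?e \<in> S" "q \<odot> c \<in> carrier N" "p \<odot> d \<in> carrier N"
      using S_smult c d SN submodule.m_closed[OF S] by auto
    have 1: "scl (Fract (p * q) 1) \<phi> - scl (Fract q 1) (sgl c) \<in> K"
      using K_closed(3)[OF c(4), of "Fract q 1"] by (simp add: scl_diff scl_scl mult.commute)
    have 2: "scl (Fract (p * q) 1) \<psi> - scl (Fract p 1) (sgl d) \<in> K"
      using K_closed(3)[OF d(4), of "Fract p 1"] by (simp add: scl_diff scl_scl)
    have 3: "sgl (q \<odot> c) - scl (Fract q 1) (sgl c) \<in> K" "sgl (p \<odot> d) - scl (Fract p 1) (sgl d) \<in> K"
      using K_smult_scl c d SN by auto
    \<comment> \<open>The difference is regrouped into elements of K: the facts \<open>1\<close> and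
      \<open>2\<close> pass to scaled numerators, \<open>3\<close> moves the scalars inside, and the
      last bracket is an additivity relation.\<close>
    have "scl (Fract (p * q) 1) (\<phi> + \<psi>) - sgl ?e =
       ((scl (Fract (p * q) 1) \<phi> - scl (Fract q 1) (sgl c)) - (sgl (q \<odot> c) - scl (Fract q 1) (sgl c)))
       + ((scl (Fract (p * q) 1) \<psi> - scl (Fract p 1) (sgl d)) - (sgl (p \<odot> d) - scl (Fract p 1) (sgl d)))
       - (sgl ?e - sgl (q \<odot> c) - sgl (p \<odot> d))"
      by (simp only: scl_add algebra_simps)
    also have "\<dots> \<in> K"
      by (rule K_closed(4)[OF K_closed(2)[OF K_closed(4)[OF 1 3(1)] K_closed(4)[OF 2 3(2)]] K_add[OF e(4,5)]])
    finally have "\<phi> + \<psi> \<in> fractions S"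
      using c(1,2) d(1,2) e(3) keys_add_subset[of \<phi> "carrier N" \<psi>]
      unfolding fractions_def by (auto intro!: exI[of _ "p * q"] exI[of _ ?e])
    then show "\<phi> \<oplus>\<^bsub>F\<^esub> \<psi> \<in> fractions S" by simp
  next
    fix r :: "'p fract" and \<phi> assume "\<phi> \<in> fractions S"
    then obtain p c where
      c: "\<phi> \<in> carrier F" "p \<noteq> 0" "c \<in> S" "scl (Fract p 1) \<phi> - sgl c \<in> K"
      unfolding fractions_def by blast
    obtain s t where r: "r = Fract s t" "t \<noteq> 0" by (cases r) auto
    have "Fract (t * p) 1 * r = Fract s 1 * Fract p 1"
      using r by (simp add: eq_fract)
    then have "scl (Fract (t * p) 1) (scl r \<phi>) - sgl (s \<odot> c)
      = scl (Fract s 1) (scl (Fract p 1) \<phi> - sgl c) - (sgl (s \<odot> c) - scl (Fract s 1) (sgl c))"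
      by (simp only: scl_scl scl_diff algebra_simps)
    also have "\<dots> \<in> K"
      by (rule K_closed(4)[OF K_closed(3)[OF c(4)] K_smult_scl[OF subsetD[OF SN c(3)]]])
    finally have "scl r \<phi> \<in> fractions S"
      using c(1-3) r(2) S_smult[of c s] keys_map_subset[of "(*) r" \<phi>]
      unfolding fractions_def by (auto intro!: exI[of _ "t * p"] exI[of _ "s \<odot> c"])
    then show "r \<odot>\<^bsub>F\<^esub> \<phi> \<in> fractions S" by simp
  qed
qed

text \<open>If q \<otimes> a is congruent to 1 \<otimes> c, then 1 \<otimes> (q a - c) vanishes, so
  q a - c is killed by some nonzero p. Hence (p q) a = p c lies in S.\<close>

lemma sgl_in_fractionsD:
  assumes S: "submodule class_ring S N" and a: "a \<in> carrier N" "sgl a \<in> fractions S"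
  shows "\<exists>p. p \<noteq> 0 \<and> p \<odot> a \<in> S"
proof -
  have SN: "S \<subseteq> carrier N" by (rule submodule.subset[OF S])
  obtain q c where c: "q \<noteq> 0" "c \<in> S" "scl (Fract q 1) (sgl a) - sgl c \<in> K"
    using a(2) unfolding fractions_def by blast
  have cN: "c \<in> carrier N" using c SN by auto
  \<comment> \<open>The negative of c is written as a scalar multiple so that the scalar relation
    relates \<open>sgl ?m\<close> to \<open>sgl c\<close>.\<close>
  let ?m = "(-1) \<odot> c"
  have m: "?m \<in> carrier N" "q \<odot> a \<in> carrier N" using cN a class_smult by auto
  have "scl (Fract (-1) 1) (sgl c) = - sgl c"
    by (simp only: Fract_1_hom scl_uminus_one)
  then have 1: "sgl ?m + sgl c \<in> K"
    using K_smult_scl[OF cN, of "-1"] by simp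
  have "sgl (q \<odot> a \<oplus> ?m) = (sgl (q \<odot> a \<oplus> ?m) - sgl (q \<odot> a) - sgl ?m)
     + (sgl (q \<odot> a) - scl (Fract q 1) (sgl a)) + (sgl ?m + sgl c) + (scl (Fract q 1) (sgl a) - sgl c)"
    by (simp only: algebra_simps)
  also have "\<dots> \<in> K"
    by (rule K_closed(2)[OF K_closed(2)[OF K_closed(2)[OF K_add[OF m(2,1)] K_smult_scl[OF a(1)]] 1] c(3)])
  finally obtain p where p: "p \<noteq> 0" "p \<odot> (q \<odot> a \<oplus> ?m) = \<zero>"
    using torsion_if_single_in_K[of "q \<odot> a \<oplus> ?m"] m by auto
  have "p \<odot> (q \<odot> a) \<oplus> \<ominus> (p \<odot> c) = \<zero>"
    using p(2) m cN smult_r_distr[of p "q \<odot> a" ?m] smult_r_minus[of p c]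
    by (simp add: class_smult)
  then have "(p * q) \<odot> a = p \<odot> c"
    using cN a by (metis M.minus_equality M.minus_minus class_smult(1) class_smult(5) M.add.inv_closed)
  then show ?thesis
    using p c submodule.smult_closed[OF S, of p c] by (auto intro!: exI[of _ "p * q"])
qed

text \<open>Each basis vector of V is the class of some (1/q) \<otimes> a with a in N. For the span
  S of these a, \<open>fractions S\<close> maps onto V and contains K, so it contains every 1
  \<otimes> c; then c has a nonzero multiple in S.\<close>

lemma rationally_spans_card_le_dim:
  assumes "V.fin_dim"
  obtains A where "rationally_spans A" "card A \<le> V.dim"
proof -
  obtain B where B: "finite B" "V.basis B"
    using V.finite_basis_exists[OF assms] by blast
  have BV: "B \<subseteq> carrier V" and gen: "V.gen_set B" using B by (auto simp: V.basis_def)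
  have sN: "submodule class_ring (carrier N) N"
    using module_axioms by (intro submodule.intro) auto
  have "\<exists>a \<phi>. a \<in> carrier N \<and> \<phi> \<in> carrier F \<and> b = K +>\<^bsub>F\<^esub> \<phi> \<and>
      (\<exists>q. q \<noteq> 0 \<and> scl (Fract q 1) \<phi> - sgl a \<in> K)" if "b \<in> B" for b
  proof -
    have "b \<in> (\<lambda>\<phi>. K +>\<^bsub>F\<^esub> \<phi>) ` carrier F"
      using subsetD[OF BV that] by (simp only: V_eq Q.carrier_quot)
    then obtain \<phi> where \<phi>: "\<phi> \<in> carrier F" "b = K +>\<^bsub>F\<^esub> \<phi>"
      by (rule imageE)
    have "Poly_Mapping.keys \<phi> \<subseteq> carrier N" using \<phi> by simp
    \<comment> \<open>Adding terms one by one under common denominators turns every tensor into a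
      single fraction modulo K.\<close>
    then have "\<phi> \<in> fractions (carrier N)"
      by (induction rule: poly_mapping_add_induct)
        (auto intro: submodule_F_closed[OF fractions_closed(1)[OF sN]] fractions_closed(3)[OF sN])
    then show ?thesis using \<phi> unfolding fractions_def by blast
  qed
  then obtain a \<phi> where a: "\<And>b. b \<in> B \<Longrightarrow> a b \<in> carrier N"
    and \<phi>: "\<And>b. b \<in> B \<Longrightarrow> \<phi> b \<in> carrier F" "\<And>b. b \<in> B \<Longrightarrow> b = K +>\<^bsub>F\<^esub> \<phi> b"
    and q: "\<And>b. b \<in> B \<Longrightarrow> \<exists>q. q \<noteq> 0 \<and> scl (Fract q 1) (\<phi> b) - sgl (a b) \<in> K"
    by metis
  let ?A = "a ` B"
  have AN: "?A \<subseteq> carrier N" using a by blast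
  have S: "submodule class_ring (span ?A) N" by (rule span_is_submodule[OF AN])
  let ?X = "fractions (span ?A)"
  have X: "submodule class_ring ?X F" by (rule fractions_closed(1)[OF S])
  have "\<phi> b \<in> ?X" if "b \<in> B" for b
    using \<phi>(1)[OF that] q[OF that] in_own_span[OF AN] that unfolding fractions_def by blast
  then have "B \<subseteq> (\<lambda>\<phi>. K +>\<^bsub>F\<^esub> \<phi>) ` ?X"
    using \<phi>(2) by blast
  from V.span_is_subset[OF this, unfolded V_eq, OF Q.submodule_image[OF X], folded V_eq] gen
  have carrier: "carrier V \<subseteq> (\<lambda>\<phi>. K +>\<^bsub>F\<^esub> \<phi>) ` ?X" by simp
  have "\<exists>p. p \<noteq> 0 \<and> p \<odot> c \<in> span ?A" if c: "c \<in> carrier N" for c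
  proof (rule sgl_in_fractionsD[OF S c])
    have "K +>\<^bsub>F\<^esub> sgl c \<in> carrier V"
      unfolding V_eq by (rule Q.coset_in_quot[OF sgl_carrier[OF c]])
    then obtain \<psi> where \<psi>: "\<psi> \<in> ?X" "K +>\<^bsub>F\<^esub> sgl c = K +>\<^bsub>F\<^esub> \<psi>"
      using carrier by blast
    have "\<psi> \<in> carrier F" using submodule.subset[OF X] \<psi> by blast
    then have "sgl c - \<psi> \<in> K"
      using Q.coset_eq_iff[OF sgl_carrier[OF c], of \<psi>] \<psi>(2) a_minus_free_space[OF sgl_carrier[OF c], of \<psi>] by simp
    then have "sgl c - \<psi> + \<psi> \<in> ?X"
      using fractions_closed(2)[OF S] \<psi>(1) by (intro submodule_F_closed(2)[OF X]) auto
    then show "sgl c \<in> ?X" by simp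
  qed
  then have "rationally_spans ?A"
    using AN B by (simp add: rationally_spans_def)
  moreover have "card ?A \<le> V.dim"
    using card_image_le[OF B(1), of a] V.dim_basis[OF B] by simp
  ultimately show thesis by (rule that)
qed

end

section \<open>Rank of a subset through rational spanning sets\<close>

definition rationally_spanning ::
    "('p::idom, 'v, 'z) module_scheme \<Rightarrow> 'v set \<Rightarrow> 'v set \<Rightarrow> bool" where
  "rationally_spanning N A T \<longleftrightarrow> finite A \<and> A \<subseteq> T \<and>
     (\<forall>a\<in>T. \<exists>p. p \<noteq> 0 \<and> p \<odot>\<^bsub>N\<^esub> a \<in> LinearCombinations.module.span class_ring N A)"

text \<open>One notion takes spans in the ambient N, the other in the record with carrier T; for
  subsets of a submodule T the two spans agree.\<close>

lemma rationally_spans_submodule: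
  fixes N :: "('p::idom, 'v, 'z) module_scheme"
  assumes N: "Module.module class_ring N" and T: "submodule class_ring T N" 
  shows "fract_extension (N\<lparr>carrier := T\<rparr>)"
    "fract_extension.rationally_spans (N\<lparr>carrier := T\<rparr>) A \<longleftrightarrow> rationally_spanning N A T"
proof -
  show *: "fract_extension (N\<lparr>carrier := T\<rparr>)"
    by (rule fract_extension.intro[OF module.submodule_is_module[OF N T]])
  show "fract_extension.rationally_spans (N\<lparr>carrier := T\<rparr>) A \<longleftrightarrow> rationally_spanning N A T"
    using module.span_li_not_depend(1)[OF N _ T, of A]
    by (auto simp: fract_extension.rationally_spans_def[OF *] rationally_spanning_def)
qed

lemma rank_le_card:
  fixes N :: "('p::idom, 'v, 'z) module_scheme"
  assumes N: "Module.module class_ring N" and S: "S \<subseteq> carrier N"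
    and A: "rationally_spanning N A (LinearCombinations.module.span class_ring N S)"
  shows "rank N S \<le> card A"
proof -
  note T = module.span_is_submodule[OF N S]
  show ?thesis
    using fract_extension.dim_le_card(2)[OF rationally_spans_submodule(1)[OF N T]]
      A rationally_spans_submodule(2)[OF N T] by (simp add: rank_def)
qed

text \<open>Converse to \<open>rank_le_card\<close>. The given A guarantees finite dimension, the
  range in which \<open>dim\<close> is meaningful; the set B then comes from a basis.\<close>

lemma rationally_spanning_card_le_rank:
  fixes N :: "('p::idom, 'v, 'z) module_scheme"
  assumes N: "Module.module class_ring N" and S: "S \<subseteq> carrier N"
    and A: "rationally_spanning N A (LinearCombinations.module.span class_ring N S)"
  obtains B where "rationally_spanning N B (LinearCombinations.module.span class_ring N S)" "card B \<le> rank N S"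
proof -
  note T = module.span_is_submodule[OF N S]
  note E = rationally_spans_submodule(1)[OF N T]
  have "vectorspace.fin_dim class_ring (fract_tensor (N\<lparr>carrier := LinearCombinations.module.span class_ring N S\<rparr>))"
    using fract_extension.dim_le_card(1)[OF E] A rationally_spans_submodule(2)[OF N T] by blast
  from fract_extension.rationally_spans_card_le_dim[OF E this] that show thesis
    unfolding rank_def rationally_spans_submodule(2)[OF N T] by blast
qed

text \<open>A spanning set A' of U together with lifts D of a spanning set of the quotient spans T
  rationally: a suitable p a equals u + y with u in U and y in \<open>span D\<close>, and a further
  multiplier q brings q u into \<open>span A'\<close>.\<close>

lemma rank_le_rank_quotient:
  fixes N :: "('p::idom, 'v, 'z) module_scheme"
  assumes N: "Module.module class_ring N" and U: "submodule class_ring U N"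
    and T: "T \<subseteq> carrier N" "U \<subseteq> T"
    and fin_U: "rationally_spanning N A U"
    and fin_T: "rationally_spanning N B (LinearCombinations.module.span class_ring N T)"
  shows "rank N T \<le> rank N U + rank (quotient_module N U) ((\<lambda>a. U +>\<^bsub>N\<^esub> a) ` T)"
proof -
  interpret Module.module class_ring N by (rule N)
  interpret Q: module_quotient class_ring N U
    by (rule module_quotient.intro[OF N module_quotient_axioms.intro[OF U]])
  let ?\<pi> = "\<lambda>a. U +>\<^bsub>N\<^esub> a"
  let ?Q = "quotient_module N U"
  have UN: "U \<subseteq> carrier N" by (rule submodule.subset[OF U])
  have span_U: "span U = U"
    using span_is_subset[OF order_refl U] in_own_span[OF UN] by blast
  have TN: "span T \<subseteq> carrier N" by (rule span_is_subset2[OF T(1)])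
  have spanT: "submodule class_ring (span T) N" by (rule span_is_submodule[OF T(1)])
  have \<pi>T: "?\<pi> ` T \<subseteq> carrier ?Q" using T(1) Q.coset_in_quot by blast
  have smult_quot: "p \<odot>\<^bsub>?Q\<^esub> ?\<pi> a = ?\<pi> (p \<odot>\<^bsub>N\<^esub> a)" if "a \<in> carrier N" for p a
    using Q.smult_quot[of p a] that by simp
  have smultN: "p \<odot>\<^bsub>N\<^esub> a \<in> carrier N" if "a \<in> carrier N" for p a
    using smult_closed[of p a] that by simp
  have BT: "B \<subseteq> span T" and BN: "B \<subseteq> carrier N" using fin_T TN by (auto simp: rationally_spanning_def)
  \<comment> \<open>The images of B only show that the quotient has finite rank, which is what
    yields the small set C.\<close>
  have "rationally_spanning ?Q (?\<pi> ` B) (Q.qspan (?\<pi> ` T))"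
    unfolding rationally_spanning_def Q.span_image[OF T(1)] Q.span_image[OF BN]
  proof (intro conjI ballI)
    show "finite (?\<pi> ` B)" using fin_T by (simp add: rationally_spanning_def)
    show "?\<pi> ` B \<subseteq> ?\<pi> ` span T" using BT by blast
    fix z assume "z \<in> ?\<pi> ` span T"
    then obtain a where a: "a \<in> span T" "z = ?\<pi> a" by blast
    then obtain p where "p \<noteq> 0" "p \<odot>\<^bsub>N\<^esub> a \<in> span B"
      using fin_T by (auto simp: rationally_spanning_def)
    then show "\<exists>p. p \<noteq> 0 \<and> p \<odot>\<^bsub>?Q\<^esub> z \<in> ?\<pi> ` span B"
      using a TN smult_quot[of a p] by (intro exI[of _ p]) auto
  qed
  from rationally_spanning_card_le_rank[OF Q.module_quot \<pi>T this] obtain C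
    where C: "rationally_spanning ?Q C (?\<pi> ` span T)" "card C \<le> rank ?Q (?\<pi> ` T)"
    unfolding Q.span_image[OF T(1)] by blast
  obtain A' where A': "rationally_spanning N A' U" "card A' \<le> rank N U"
    using rationally_spanning_card_le_rank[OF N UN, unfolded span_U, OF fin_U] by blast
  have "C \<subseteq> ?\<pi> ` span T" "finite C" using C by (auto simp: rationally_spanning_def)
  \<comment> \<open>One lift for each element of C, so that D is no larger than C.\<close>
  then obtain D where D: "D \<subseteq> span T" "finite D" "C = ?\<pi> ` D" "card D = card C"
    by (metis finite_imageD subset_image_inj card_image)
  have DN: "D \<subseteq> carrier N" and A'N: "A' \<subseteq> carrier N" using D TN A' UN by (auto simp: rationally_spanning_def)
  let ?E = "A' \<union> D"
  have E: "?E \<subseteq> carrier N" using A'N DN by blast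
  have "rationally_spanning N ?E (span T)"
    unfolding rationally_spanning_def
  proof (intro conjI ballI)
    show "finite ?E" using A' D by (simp add: rationally_spanning_def)
    show "?E \<subseteq> span T" using A' D T in_own_span[OF T(1)] by (auto simp: rationally_spanning_def)
    fix a assume a: "a \<in> span T"
    then have aN: "a \<in> carrier N" using TN by blast
    obtain p where p: "p \<noteq> 0" "p \<odot>\<^bsub>?Q\<^esub> ?\<pi> a \<in> Q.qspan C"
      using C(1) a by (auto simp: rationally_spanning_def)
    then have "?\<pi> (p \<odot>\<^bsub>N\<^esub> a) \<in> ?\<pi> ` span D"
      using aN by (simp add: D(3) Q.span_image[OF DN] smult_quot)
    then obtain y where y: "y \<in> span D" "?\<pi> (p \<odot>\<^bsub>N\<^esub> a) = ?\<pi> y" by blast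
    have yN: "y \<in> carrier N" using y span_is_subset2[OF DN] by blast
    let ?u = "p \<odot>\<^bsub>N\<^esub> a \<ominus>\<^bsub>N\<^esub> y"
    have u: "?u \<in> U" "?u \<in> carrier N"
      using y(2) Q.coset_eq_iff[OF smultN[OF aN] yN] UN by auto
    then obtain q where q: "q \<noteq> 0" "q \<odot>\<^bsub>N\<^esub> ?u \<in> span A'"
      using A' by (auto simp: rationally_spanning_def)
    have E_sub: "submodule class_ring (span ?E) N" by (rule span_is_submodule[OF E])
    have 1: "q \<odot>\<^bsub>N\<^esub> ?u \<in> span ?E" "y \<in> span ?E"
      using q(2) y(1) span_is_monotone[of A' ?E] span_is_monotone[of D ?E] by auto
    have "p \<odot>\<^bsub>N\<^esub> a = ?u \<oplus>\<^bsub>N\<^esub> y"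
      using yN smultN[OF aN, of p] by (simp add: a_minus_def M.a_assoc M.l_neg)
    then have "(q * p) \<odot>\<^bsub>N\<^esub> a = q \<odot>\<^bsub>N\<^esub> (?u \<oplus>\<^bsub>N\<^esub> y)"
      using aN smult_assoc1[of q p a] by simp
    also have "\<dots> = q \<odot>\<^bsub>N\<^esub> ?u \<oplus>\<^bsub>N\<^esub> q \<odot>\<^bsub>N\<^esub> y"
      using u yN smult_r_distr[of q ?u y] by simp
    also have "\<dots> \<in> span ?E"
      using 1 submodule.m_closed[OF E_sub] submodule.smult_closed[OF E_sub, of q y] by simp
    finally show "\<exists>p. p \<noteq> 0 \<and> p \<odot>\<^bsub>N\<^esub> a \<in> span ?E"
      using p(1) q(1) by (intro exI[of _ "q * p"]) simp
  qed
  from rank_le_card[OF N T(1) this] have "rank N T \<le> card ?E" .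
  also have "\<dots> \<le> card A' + card D" by (rule card_Un_le)
  finally show ?thesis using A'(2) C(2) D(4) by linarith
qed

section \<open>Partial derivatives and derivations\<close>

abbreviation var :: "'n \<Rightarrow> ('n, 'k::field) mpoly" where
  "var i \<equiv> Poly_Mapping.single (Poly_Mapping.single i 1) 1"

text \<open>At an exponent without the i-th variable the truncated subtraction leaves m unchanged,
  but the coefficient there carries the factor 0.\<close>

definition pderiv_mpoly :: "'n \<Rightarrow> ('n, 'k::field) mpoly \<Rightarrow> ('n, 'k) mpoly" where
  "pderiv_mpoly i f = (\<Sum>m\<in>Poly_Mapping.keys f. Poly_Mapping.single (m - Poly_Mapping.single i 1)
     (of_nat (Poly_Mapping.lookup m i) * Poly_Mapping.lookup f m))"

lemma pderiv_mpoly_superset: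
  assumes "finite S" "Poly_Mapping.keys f \<subseteq> S"
  shows "pderiv_mpoly i f = (\<Sum>m\<in>S. Poly_Mapping.single (m - Poly_Mapping.single i 1)
     (of_nat (Poly_Mapping.lookup m i) * Poly_Mapping.lookup f m))"
  unfolding pderiv_mpoly_def using assms
  by (intro sum.mono_neutral_left) (auto simp: in_keys_iff)

lemma pderiv_mpoly_add: "pderiv_mpoly i (f + g) = pderiv_mpoly i f + pderiv_mpoly i g"
proof -
  let ?S = "Poly_Mapping.keys f \<union> Poly_Mapping.keys g"
  have "finite ?S" "Poly_Mapping.keys f \<subseteq> ?S" "Poly_Mapping.keys g \<subseteq> ?S" "Poly_Mapping.keys (f + g) \<subseteq> ?S"
    using Poly_Mapping.keys_add[of f g] by auto
  then show ?thesis
    by (simp only: pderiv_mpoly_superset[of ?S] lookup_add distrib_left single_add sum.distrib)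
qed

lemma pderiv_mpoly_single:
  "pderiv_mpoly i (Poly_Mapping.single m c) =
    Poly_Mapping.single (m - Poly_Mapping.single i 1) (of_nat (Poly_Mapping.lookup m i) * c)"
  by (subst pderiv_mpoly_superset[of "{m}"]) auto

lemma pderiv_mpoly_zero [simp]: "pderiv_mpoly i 0 = 0"
  by (simp add: pderiv_mpoly_def)

text \<open>Additivity in each factor reduces the product rule to two monomials, where it is the
  distribution of the exponent sum over its two summands.\<close>

lemma pderiv_mpoly_mult: "pderiv_mpoly i (f * g) = pderiv_mpoly i f * g + f * pderiv_mpoly i g"
proof -
  have mono: "pderiv_mpoly i (Poly_Mapping.single m c * Poly_Mapping.single l d) =
      pderiv_mpoly i (Poly_Mapping.single m c) * Poly_Mapping.single l d +
      Poly_Mapping.single m c * pderiv_mpoly i (Poly_Mapping.single l d)" for m l and c d :: 'b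
  proof -
    \<comment> \<open>Truncated subtraction commutes with adding l only when m contains the i-th
      variable; otherwise the coefficient in \<open>*\<close> vanishes on both sides.\<close>
    have shift: "m - Poly_Mapping.single i 1 + l = m + l - Poly_Mapping.single i 1"
      if "Poly_Mapping.lookup m i \<noteq> 0" for m l :: "'a \<Rightarrow>\<^sub>0 nat"
      using that by (auto simp: poly_mapping_eq_iff fun_eq_iff lookup_add lookup_minus lookup_single when_def)
    have *: "Poly_Mapping.single (m - Poly_Mapping.single i 1 + l) (of_nat (Poly_Mapping.lookup m i) * (c * d))
        = Poly_Mapping.single (m + l - Poly_Mapping.single i 1) (of_nat (Poly_Mapping.lookup m i) * (c * d))" for m l
      using shift[of m l] by (cases "Poly_Mapping.lookup m i = 0") auto
    have "Poly_Mapping.single (m + l - Poly_Mapping.single i 1) (of_nat (Poly_Mapping.lookup (m + l) i) * (c * d))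
      = Poly_Mapping.single (m - Poly_Mapping.single i 1 + l) (of_nat (Poly_Mapping.lookup m i) * (c * d))
        + Poly_Mapping.single (m + (l - Poly_Mapping.single i 1)) (of_nat (Poly_Mapping.lookup l i) * (c * d))"
      using *[of m l] *[of l m] by (simp add: lookup_add single_add[symmetric] distrib_right add.commute)
    then show ?thesis
      unfolding mult_single pderiv_mpoly_single by (simp add: mult_ac)
  qed
  have mono_left: "pderiv_mpoly i (Poly_Mapping.single m c * g) =
      pderiv_mpoly i (Poly_Mapping.single m c) * g + Poly_Mapping.single m c * pderiv_mpoly i g" for m c
    using subset_UNIV[of "Poly_Mapping.keys g"]
    by (induction rule: poly_mapping_add_induct) (simp_all add: distrib_left pderiv_mpoly_add mono)
  show ?thesis
    using subset_UNIV[of "Poly_Mapping.keys f"]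
    by (induction rule: poly_mapping_add_induct) (simp_all add: distrib_right pderiv_mpoly_add mono_left)
qed

text \<open>Shifting m upwards avoids truncated subtraction. This form gives both the drop in degree
  and the criterion for vanishing derivatives below.\<close>

lemma lookup_pderiv_mpoly:
  "Poly_Mapping.lookup (pderiv_mpoly i f) m =
    of_nat (Suc (Poly_Mapping.lookup m i)) * Poly_Mapping.lookup f (m + Poly_Mapping.single i 1)"
  using subset_UNIV[of "Poly_Mapping.keys f"]
proof (induction rule: poly_mapping_add_induct)
  case (add f l c)
  have "Poly_Mapping.lookup (pderiv_mpoly i (Poly_Mapping.single l c)) m =
      of_nat (Suc (Poly_Mapping.lookup m i)) * Poly_Mapping.lookup (Poly_Mapping.single l c) (m + Poly_Mapping.single i 1)"
  proof (cases "Poly_Mapping.lookup l i")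
    case 0
    then have "l \<noteq> m + Poly_Mapping.single i 1" by (auto simp: lookup_add)
    then show ?thesis using 0 by (simp add: pderiv_mpoly_single lookup_single when_def)
  next
    case (Suc k)
    then have "l - Poly_Mapping.single i 1 = m \<longleftrightarrow> l = m + Poly_Mapping.single i 1"
      by (auto simp: poly_mapping_eq_iff fun_eq_iff lookup_add lookup_minus lookup_single when_def split: if_splits)
    then show ?thesis
      by (auto simp: pderiv_mpoly_single lookup_single when_def lookup_add)
  qed
  then show ?case
    using add by (simp only: pderiv_mpoly_add lookup_add distrib_left)
qed simp

text \<open>Induction on a bound d for the total degree. Some nonzero partial derivative has smaller
  degree and lies in C again; if all of them vanish, the polynomial is a nonzero constant, hence a
  unit.\<close>

lemma one_in_differential_ideal:
  fixes C :: "('n::finite, 'k::field_char_0) mpoly set"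
  assumes add: "\<And>f g. f \<in> C \<Longrightarrow> g \<in> C \<Longrightarrow> f + g \<in> C" and mult: "\<And>f g. g \<in> C \<Longrightarrow> f * g \<in> C"
    and pd: "\<And>i f. f \<in> C \<Longrightarrow> pderiv_mpoly i f \<in> C"
    and f: "f \<in> C" "f \<noteq> 0"
  shows "1 \<in> C"
proof -
  let ?deg = "\<lambda>m. \<Sum>i\<in>UNIV. Poly_Mapping.lookup m i :: nat"
  have const: "1 \<in> C" if "f \<in> C" "f \<noteq> 0" "Poly_Mapping.keys f \<subseteq> {0}" for f
  proof -
    have eq: "f = scalar (Poly_Mapping.lookup f 0)"
      using that(3) by (intro poly_mapping_eqI) (auto simp: lookup_single when_def in_keys_iff)
    then have "Poly_Mapping.lookup f 0 \<noteq> 0" using that(2) by auto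
    then have "scalar (inverse (Poly_Mapping.lookup f 0)) * f = 1"
      by (subst (2) eq) (simp add: mult_single)
    then show ?thesis using mult[OF that(1)] by metis
  qed
  have "1 \<in> C" if "f \<in> C" "f \<noteq> 0" "\<forall>m\<in>Poly_Mapping.keys f. ?deg m \<le> d" for f d
    using that
  proof (induction d arbitrary: f)
    case 0
    then have "Poly_Mapping.keys f \<subseteq> {0}"
      by (auto simp: poly_mapping_eq_iff fun_eq_iff)
    then show ?case using const 0 by blast
  next
    case (Suc d)
    show ?case
    proof (cases "\<exists>i. pderiv_mpoly i f \<noteq> 0")
      case True
      then obtain i where i: "pderiv_mpoly i f \<noteq> 0" by blast
      have "?deg m \<le> d" if "m \<in> Poly_Mapping.keys (pderiv_mpoly i f)" for m
      proof -
        from that have "m + Poly_Mapping.single i 1 \<in> Poly_Mapping.keys f"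
          by (auto simp: in_keys_iff lookup_pderiv_mpoly)
        then have "?deg (m + Poly_Mapping.single i 1) \<le> Suc d" using Suc.prems by blast
        then show ?thesis by (simp add: lookup_add sum.distrib lookup_single when_def)
      qed
      then show ?thesis using Suc.IH[OF pd[OF Suc.prems(1)] i] by blast
    next
      case False
      have "Poly_Mapping.keys f \<subseteq> {0}"
      proof
        fix m assume m: "m \<in> Poly_Mapping.keys f"
        have "Poly_Mapping.lookup m i = 0" for i
        proof (rule ccontr)
          assume "Poly_Mapping.lookup m i \<noteq> 0"
          then have "m = (m - Poly_Mapping.single i 1) + Poly_Mapping.single i 1"
            by (auto simp: poly_mapping_eq_iff fun_eq_iff lookup_add lookup_minus lookup_single when_def)
          \<comment> \<open>Characteristic zero enters here: the nonzero coefficient of m reappears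
            multiplied by the positive integer \<open>lookup m i\<close>.\<close>
          then have "Poly_Mapping.lookup (pderiv_mpoly i f) (m - Poly_Mapping.single i 1) \<noteq> 0"
            using m lookup_pderiv_mpoly[of i f "m - Poly_Mapping.single i 1"]
            by (auto simp: in_keys_iff simp del: of_nat_Suc)
          then show False using False by simp
        qed
        then show "m \<in> {0}" by (simp add: poly_mapping_eq_iff fun_eq_iff)
      qed
      then show ?thesis using const Suc.prems by blast
    qed
  qed
  from this[OF f, of "Max (?deg ` Poly_Mapping.keys f)"] show ?thesis by simp
qed

section \<open>Derivations and their values on the variables\<close>

lemma derivationsD:
  assumes "D \<in> derivations"
  shows "D (f + g) = D f + D g" "D (scalar c * f) = scalar c * D f" "D (f * g) = D f * g + f * D g"
  using assms by (auto simp: derivations_def)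

lemma derivations_zero: "D \<in> derivations \<Longrightarrow> D 0 = 0"
  using derivationsD(1)[of D 0 0] by simp

lemma derivations_one: "D \<in> derivations \<Longrightarrow> D 1 = 0"
  using derivationsD(3)[of D 1 1] by simp

lemma derivations_diff: "D \<in> derivations \<Longrightarrow> D (f - g) = D f - D g"
  using derivationsD(1)[of D "f - g" g] by simp

lemma derivations_scalar: "D \<in> derivations \<Longrightarrow> D (scalar c) = 0"
  using derivationsD(2)[of D c 1] derivations_one[of D] by simp

abbreviation zero_der :: "('n, 'k::field) mpoly \<Rightarrow> ('n, 'k) mpoly" where
  "zero_der \<equiv> \<lambda>f. 0"

abbreviation bracket_der where
  "bracket_der D E \<equiv> \<lambda>f. D (E f) - E (D f)"

lemma derivations_closed:
  shows "zero_der \<in> derivations"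
    and "D \<in> derivations \<Longrightarrow> E \<in> derivations \<Longrightarrow> (\<lambda>f. D f + E f) \<in> derivations"
    and "D \<in> derivations \<Longrightarrow> (\<lambda>f. p * D f) \<in> derivations"
    and "D \<in> derivations \<Longrightarrow> E \<in> derivations \<Longrightarrow> bracket_der D E \<in> derivations"
proof -
  show "zero_der \<in> derivations"
    and "D \<in> derivations \<Longrightarrow> E \<in> derivations \<Longrightarrow> (\<lambda>f. D f + E f) \<in> derivations"
    and "D \<in> derivations \<Longrightarrow> (\<lambda>f. p * D f) \<in> derivations"
    by (auto simp: derivations_def algebra_simps)
  assume "D \<in> derivations" "E \<in> derivations"
  then show "bracket_der D E \<in> derivations"
    by (subst derivations_def) (auto simp: derivationsD derivations_scalar derivations_diff derivations_zero algebra_simps)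
qed

lemma pderiv_mpoly_derivation:
  "(pderiv_mpoly i :: ('n, 'k::field) mpoly \<Rightarrow> ('n, 'k) mpoly) \<in> derivations"
proof -
  have "pderiv_mpoly i (scalar c) = 0" for c :: 'k
    by (simp add: pderiv_mpoly_single)
  then show ?thesis
    by (auto simp: derivations_def pderiv_mpoly_add pderiv_mpoly_mult)
qed

lemma pderiv_mpoly_var: "pderiv_mpoly i (var j) = (if i = j then 1 else 0)"
  by (simp add: pderiv_mpoly_single lookup_single when_def)

text \<open>Agreement spreads by the product rule from variables to their powers and then to
  monomials, and by linearity to all polynomials.\<close>

lemma derivation_eqI:
  assumes D: "D \<in> derivations" and E: "E \<in> derivations" and eq: "\<And>i. D (var i) = E (var i)"
  shows "D = E"
proof
  fix f
  have power: "D (Poly_Mapping.single (Poly_Mapping.single i k) 1) = E (Poly_Mapping.single (Poly_Mapping.single i k) 1)" for i k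
  proof (induction k)
    case (Suc k)
    have "Poly_Mapping.single (Poly_Mapping.single i (Suc k)) (1::'b) = var i * Poly_Mapping.single (Poly_Mapping.single i k) 1"
      by (simp add: mult_single single_add[symmetric])
    then show ?case
      by (simp only: derivationsD(3)[OF D] derivationsD(3)[OF E] eq Suc)
  qed (use D E in \<open>simp add: derivations_one\<close>)
  have mono: "D (Poly_Mapping.single m 1) = E (Poly_Mapping.single m 1)" for m
    using subset_UNIV[of "Poly_Mapping.keys m"]
  proof (induction rule: poly_mapping_add_induct)
    case (add m i k)
    have "Poly_Mapping.single (m + Poly_Mapping.single i k) (1::'b) =
        Poly_Mapping.single m 1 * Poly_Mapping.single (Poly_Mapping.single i k) 1"
      by (simp add: mult_single)
    then show ?case
      by (simp only: derivationsD(3)[OF D] derivationsD(3)[OF E] power add)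
  qed (use D E in \<open>simp add: derivations_one\<close>)
  show "D f = E f"
    using subset_UNIV[of "Poly_Mapping.keys f"]
  proof (induction rule: poly_mapping_add_induct)
    case (add f m c)
    have "Poly_Mapping.single m c = scalar c * Poly_Mapping.single m 1"
      by (simp add: mult_single)
    then have "D (Poly_Mapping.single m c) = E (Poly_Mapping.single m c)"
      by (simp only: derivationsD(2)[OF D] derivationsD(2)[OF E] mono)
    with add show ?case
      by (simp only: derivationsD(1)[OF D] derivationsD(1)[OF E])
  qed (use D E in \<open>simp add: derivations_zero\<close>)
qed

text \<open>Both sides are derivations with the same values on the variables, so
  \<open>derivation_eqI\<close> applies.\<close>

lemma derivation_expansion:
  fixes D :: "('n::finite, 'k::field) mpoly \<Rightarrow> ('n, 'k) mpoly"
  assumes D: "D \<in> derivations"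
  shows "D = (\<lambda>f. \<Sum>i\<in>UNIV. D (var i) * pderiv_mpoly i f)"
proof (rule derivation_eqI[OF D])
  show "(\<lambda>f. \<Sum>i\<in>UNIV. D (var i) * pderiv_mpoly i f) \<in> derivations"
  proof -
    have "(\<lambda>f. \<Sum>i\<in>I. D (var i) * pderiv_mpoly i f) \<in> derivations" for I
      by (induction I rule: infinite_finite_induct)
        (simp_all add: derivations_closed pderiv_mpoly_derivation)
    then show ?thesis .
  qed
  show "D (var j) = (\<Sum>i\<in>UNIV. D (var i) * pderiv_mpoly i (var j))" for j
    unfolding pderiv_mpoly_var by (simp add: if_distrib cong: if_cong)
qed

section \<open>W_n as a module over the polynomials and as a Lie algebra\<close>

lemma W_module_simps [simp]:
  "carrier W_module = derivations" "\<zero>\<^bsub>W_module\<^esub> = zero_der"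
  "D \<oplus>\<^bsub>W_module\<^esub> E = (\<lambda>f. D f + E f)" "p \<odot>\<^bsub>W_module\<^esub> D = (\<lambda>f. p * D f)"
  by (simp_all add: W_module_def)

lemma W_lie_simps [simp]:
  "carrier W_lie = derivations" "\<zero>\<^bsub>W_lie\<^esub> = zero_der"
  "D \<oplus>\<^bsub>W_lie\<^esub> E = (\<lambda>f. D f + E f)" "c \<odot>\<^bsub>W_lie\<^esub> D = (\<lambda>f. scalar c * D f)"
  "bracket W_lie D E = bracket_der D E"
  by (simp_all add: W_lie_def)

lemma module_W_module:
  "Module.module class_ring (W_module :: (('n::linorder, 'k::field) mpoly, ('n, 'k) mpoly \<Rightarrow> ('n, 'k) mpoly) module)"
proof (rule moduleI)
  show "abelian_group (W_module :: (('n, 'k) mpoly, ('n, 'k) mpoly \<Rightarrow> ('n, 'k) mpoly) module)"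
  proof (rule abelian_groupI)
    fix D :: "('n, 'k) mpoly \<Rightarrow> ('n, 'k) mpoly" assume "D \<in> carrier W_module"
    then show "\<exists>E\<in>carrier W_module. E \<oplus>\<^bsub>W_module\<^esub> D = \<zero>\<^bsub>W_module\<^esub>"
      using derivations_closed(3)[of D "-1"] by (intro bexI[of _ "\<lambda>f. -1 * D f"]) auto
  qed (auto simp: derivations_closed add_ac)
qed (simp_all add: derivations_closed algebra_simps class_cring.cring_axioms)

lemma module_W_lie:
  "Module.module class_ring (W_lie :: ('k::field, ('n, 'k) mpoly \<Rightarrow> ('n, 'k) mpoly) lie_algebra)"
proof (rule moduleI)
  show "abelian_group (W_lie :: ('k, ('n, 'k) mpoly \<Rightarrow> ('n, 'k) mpoly) lie_algebra)"
  proof (rule abelian_groupI)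
    fix D :: "('n, 'k) mpoly \<Rightarrow> ('n, 'k) mpoly" assume "D \<in> carrier W_lie"
    then show "\<exists>E\<in>carrier W_lie. E \<oplus>\<^bsub>W_lie\<^esub> D = \<zero>\<^bsub>W_lie\<^esub>"
      using derivations_closed(3)[of D "-1"] by (intro bexI[of _ "\<lambda>f. -1 * D f"]) auto
  qed (auto simp: derivations_closed add_ac)
qed (simp_all add: derivations_closed distrib_left distrib_right mult.assoc[symmetric] mult_single
    class_cring.cring_axioms single_add)

lemma polynomial_iff:
  fixes U :: "(('n::linorder, 'k::field) mpoly \<Rightarrow> ('n, 'k) mpoly) set"
  shows "polynomial U \<longleftrightarrow> U \<subseteq> derivations \<and> zero_der \<in> U \<and>
    (\<forall>D\<in>U. \<forall>E\<in>U. (\<lambda>f. D f + E f) \<in> U) \<and> (\<forall>p. \<forall>D\<in>U. (\<lambda>f. p * D f) \<in> U)"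
  unfolding polynomial_def submodule_def using module_W_module by auto

lemma lie_subalgebra_W_iff:
  "lie_subalgebra W_lie U \<longleftrightarrow> U \<subseteq> derivations \<and> zero_der \<in> U \<and>
    (\<forall>D\<in>U. \<forall>E\<in>U. (\<lambda>f. D f + E f) \<in> U) \<and> (\<forall>c. \<forall>D\<in>U. (\<lambda>f. scalar c * D f) \<in> U) \<and>
    (\<forall>D\<in>U. \<forall>E\<in>U. bracket_der D E \<in> U)"
  unfolding lie_subalgebra_def submodule_def using module_W_lie by auto

lemma lie_ideal_W_iff:
  assumes "lie_subalgebra W_lie M"
  shows "lie_ideal (W_lie\<lparr>carrier := M\<rparr>) J \<longleftrightarrow> J \<subseteq> M \<and> zero_der \<in> J \<and>
    (\<forall>D\<in>J. \<forall>E\<in>J. (\<lambda>f. D f + E f) \<in> J) \<and> (\<forall>c. \<forall>D\<in>J. (\<lambda>f. scalar c * D f) \<in> J) \<and>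
    (\<forall>D\<in>M. \<forall>E\<in>J. bracket_der D E \<in> J)"
proof -
  have "Module.module class_ring (W_lie\<lparr>carrier := M\<rparr>)"
    using assms unfolding lie_subalgebra_def by (intro module.submodule_is_module[OF module_W_lie]) auto
  then show ?thesis
    unfolding lie_ideal_def submodule_def by auto
qed

section \<open>Polynomial spans and coordinates over the rational functions\<close>

abbreviation W_span where "W_span \<equiv> LinearCombinations.module.span class_ring W_module"

lemma W_span:
  fixes S :: "(('n::linorder, 'k::field) mpoly \<Rightarrow> ('n, 'k) mpoly) set"
  assumes "S \<subseteq> derivations"
  shows "polynomial (W_span S)" "S \<subseteq> W_span S" "polynomial U \<Longrightarrow> S \<subseteq> U \<Longrightarrow> W_span S \<subseteq> U"
  using module.span_is_submodule[OF module_W_module, of S] module.in_own_span[OF module_W_module, of S]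
    module.span_is_subset[OF module_W_module, of S U] assms
  by (auto simp: polynomial_def)

text \<open>The coordinates with respect to the partial derivatives. They embed W_n into the
  n-dimensional space over the field of rational functions, where rank becomes
  \<open>vec.dim\<close>.\<close>

definition components ::
    "(('n::{finite,linorder}, 'k::field) mpoly \<Rightarrow> ('n, 'k) mpoly) \<Rightarrow> ('n, 'k) mpoly fract ^ ('n::{finite,linorder})" where
  "components D = (\<chi> i. Fract (D (var i)) 1)"

lemma components_add: "components (\<lambda>f. D f + E f) = components D + components E"
  and components_smult: "components (\<lambda>f. p * D f) = Fract p 1 *s components D"
  and components_zero: "components zero_der = 0"
  by (simp_all add: components_def Finite_Cartesian_Product.vec_eq_iff Fract_1_hom del: add_fract mult_fract)

lemma components_pderiv: "components (pderiv_mpoly i) = axis i 1"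
  unfolding components_def Finite_Cartesian_Product.vec_eq_iff axis_def pderiv_mpoly_var
  by (auto simp: Fract_1_hom)

lemma components_inject:
  assumes "D \<in> derivations" "E \<in> derivations" "components D = components E"
  shows "D = E"
  using assms(3) by (intro derivation_eqI[OF assms(1,2)]) (simp add: components_def Finite_Cartesian_Product.vec_eq_iff eq_fract)

text \<open>Clearing denominators: the vectors with a nonzero polynomial multiple among the
  coordinate vectors of U form a subspace, which therefore contains the span. Injectivity of
  \<open>components\<close> carries the conclusion back to derivations.\<close>

lemma multiple_in_polynomial_if_components_in_span:
  assumes U: "polynomial U" and D: "D \<in> derivations" "components D \<in> vec.span (components ` U)"
  shows "\<exists>p. p \<noteq> 0 \<and> (\<lambda>f. p * D f) \<in> U"
proof -
  have Ud: "U \<subseteq> derivations" and U0: "zero_der \<in> U"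
    and Uadd: "\<And>D E. D \<in> U \<Longrightarrow> E \<in> U \<Longrightarrow> (\<lambda>f. D f + E f) \<in> U"
    and Usmult: "\<And>p D. D \<in> U \<Longrightarrow> (\<lambda>f. p * D f) \<in> U"
    using U by (auto simp: polynomial_iff)
  let ?Z = "{v. \<exists>p D. p \<noteq> 0 \<and> D \<in> U \<and> Fract p 1 *s v = components D}"
  have "vec.subspace ?Z"
  proof (rule vec.subspaceI)
    show "0 \<in> ?Z"
      using U0 components_zero by (auto intro!: exI[of _ 1] exI[of _ zero_der])
    fix v w assume "v \<in> ?Z" "w \<in> ?Z"
    then obtain p D q E where p: "p \<noteq> 0" "D \<in> U" "Fract p 1 *s v = components D"
      and q: "q \<noteq> 0" "E \<in> U" "Fract q 1 *s w = components E" by blast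
    have "Fract (p * q) 1 *s (v + w) = components (\<lambda>f. q * D f + p * E f)"
      unfolding components_add components_smult p(3)[symmetric] q(3)[symmetric] Fract_1_hom
      by (simp only: vec.scale_scale vec.scale_right_distrib mult.commute)
    moreover have "(\<lambda>f. q * D f + p * E f) \<in> U"
      using Uadd[OF Usmult[OF p(2)] Usmult[OF q(2)]] .
    ultimately show "v + w \<in> ?Z"
      using p(1) q(1) mult_eq_0_iff[of p q] by blast
  next
    fix c :: "('a, 'b) mpoly fract" and v assume "v \<in> ?Z"
    then obtain p D where p: "p \<noteq> 0" "D \<in> U" "Fract p 1 *s v = components D" by blast
    obtain s t where c: "c = Fract s t" "t \<noteq> 0" by (cases c) auto
    have "Fract (t * p) 1 * c = Fract s 1 * Fract p 1"
      using c by (simp add: eq_fract)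
    then have "Fract (t * p) 1 *s (c *s v) = components (\<lambda>f. s * D f)"
      unfolding components_smult p(3)[symmetric] by (simp only: vec.scale_scale)
    then show "c *s v \<in> ?Z"
      using Usmult[OF p(2), of s] p(1) c(2) mult_eq_0_iff[of t p] by blast
  qed
  moreover have "components ` U \<subseteq> ?Z"
    by (auto intro!: exI[of _ 1] simp: Fract_1_hom)
  ultimately have "components D \<in> ?Z"
    using vec.span_minimal D(2) by blast
  then obtain p E where p: "p \<noteq> 0" "E \<in> U" "components (\<lambda>f. p * D f) = components E"
    by (auto simp: components_smult)
  then have "(\<lambda>f. p * D f) = E"
    using Ud D(1) by (intro components_inject) (auto intro: derivations_closed)
  then show ?thesis using p by blast
qed

lemma components_W_span:
  assumes S: "S \<subseteq> derivations"
  shows "components ` W_span S \<subseteq> vec.span (components ` S)"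
proof -
  have "polynomial {D \<in> derivations. components D \<in> vec.span (components ` S)}"
    unfolding polynomial_iff
    by (auto simp: components_add components_smult components_zero derivations_closed
        intro: vec.span_add vec.span_scale vec.span_zero)
  then have "W_span S \<subseteq> {D \<in> derivations. components D \<in> vec.span (components ` S)}"
    using S by (intro W_span(3)) (auto intro: vec.span_base)
  then show ?thesis by blast
qed

text \<open>Forwards, the multiplier p can be divided out in the vector space; backwards, the
  denominators of a linear combination are cleared.\<close>

lemma rationally_spanning_W_iff:
  assumes U: "polynomial U" and A: "A \<subseteq> U" "finite A"
  shows "rationally_spanning W_module A U \<longleftrightarrow> components ` U \<subseteq> vec.span (components ` A)"
proof -
  have Ud: "U \<subseteq> derivations" using U by (auto simp: polynomial_iff)
  then have Ad: "A \<subseteq> derivations" using A by blast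
  show ?thesis
  proof
    assume R: "rationally_spanning W_module A U"
    show "components ` U \<subseteq> vec.span (components ` A)"
    proof safe
      fix D assume D: "D \<in> U"
      then obtain p where p: "p \<noteq> 0" "(\<lambda>f. p * D f) \<in> W_span A"
        using R by (auto simp: rationally_spanning_def)
      then have "Fract p 1 *s components D \<in> vec.span (components ` A)"
        using components_W_span[OF Ad] by (auto simp: components_smult[symmetric])
      moreover have "Fract 1 p * Fract p 1 = 1"
        using p(1) by (simp add: eq_fract One_fract_def)
      ultimately show "components D \<in> vec.span (components ` A)"
        using vec.span_scale[of "Fract p 1 *s components D" _ "Fract 1 p"]
        by (simp only: vec.scale_scale vec.scale_one)
    qed
  next
    assume "components ` U \<subseteq> vec.span (components ` A)"
    then have "\<exists>p. p \<noteq> 0 \<and> (\<lambda>f. p * D f) \<in> W_span A" if "D \<in> U" for D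
      using that Ud vec.span_mono[of "components ` A" "components ` W_span A"] W_span(2)[OF Ad]
      by (intro multiple_in_polynomial_if_components_in_span[OF W_span(1)[OF Ad]]) auto
    then show "rationally_spanning W_module A U"
      using A by (simp add: rationally_spanning_def)
  qed
qed

text \<open>A basis of the coordinate span is chosen among the vectors of U and lifted. It supplies
  the finite spanning sets that the rank lemmas ask for.\<close>

lemma rationally_spanning_exists:
  assumes U: "polynomial U"
  obtains A where "rationally_spanning W_module A U" "card A = vec.dim (components ` U)"
proof -
  obtain B where B: "B \<subseteq> components ` U" "vec.independent B" "components ` U \<subseteq> vec.span B"
    "card B = vec.dim (components ` U)"
    using vec.basis_exists[of "components ` U"] by blast
  have "finite B" using vec.finiteI_independent[OF B(2)] .
  then obtain A where "A \<subseteq> U" "finite A" "B = components ` A" "card A = card B"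
    by (metis B(1) finite_imageD subset_image_inj card_image)
  then show thesis
    using that rationally_spanning_W_iff[OF U] B by metis
qed

text \<open>A lifted basis bounds the rank from above; conversely the coordinates of any rational
  spanning set span, so such a set has at least \<open>vec.dim\<close> elements.\<close>

lemma rank_W_module:
  assumes S: "S \<subseteq> derivations"
  shows "rank W_module S = vec.dim (components ` W_span S)"
proof (rule antisym)
  note U = W_span(1)[OF S]
  have SW: "S \<subseteq> carrier W_module" using S by simp
  obtain A where A: "rationally_spanning W_module A (W_span S)" "card A = vec.dim (components ` W_span S)"
    by (rule rationally_spanning_exists[OF U])
  show "rank W_module S \<le> vec.dim (components ` W_span S)"
    using rank_le_card[OF module_W_module SW A(1)] A(2) by simp
  obtain B where B: "rationally_spanning W_module B (W_span S)" "card B \<le> rank W_module S"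
    by (rule rationally_spanning_card_le_rank[OF module_W_module SW A(1)])
  then have "B \<subseteq> W_span S" "finite B" by (auto simp: rationally_spanning_def)
  then have "vec.dim (components ` W_span S) \<le> card (components ` B)"
    using rationally_spanning_W_iff[OF U] B by (intro vec.dim_le_card) auto
  also have "\<dots> \<le> rank W_module S"
    using card_image_le[OF \<open>finite B\<close>, of components] B(2) by linarith
  finally show "vec.dim (components ` W_span S) \<le> rank W_module S" .
qed

lemma rank_W_module_le:
  fixes S :: "(('n::{finite,linorder}, 'k::field) mpoly \<Rightarrow> ('n, 'k) mpoly) set"
  shows "S \<subseteq> derivations \<Longrightarrow> rank W_module S \<le> CARD('n)"
  by (simp add: rank_W_module dim_subset_UNIV_cart_gen)

text \<open>At full rank each partial derivative has a nonzero multiple by some p i in the span, and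
  the product of all p i is a common multiplier for W_n. Conversely, dividing the multiples of the
  partial derivatives by p yields all unit vectors.\<close>

lemma rank_W_module_eq_iff:
  fixes S :: "(('n::{finite,linorder}, 'k::field) mpoly \<Rightarrow> ('n, 'k) mpoly) set"
  assumes S: "S \<subseteq> derivations"
  shows "rank W_module S = CARD('n) \<longleftrightarrow> (\<exists>p. p \<noteq> 0 \<and> (\<forall>D\<in>derivations. (\<lambda>f. p * D f) \<in> W_span S))"
    (is "_ \<longleftrightarrow> ?R")
proof -
  let ?U = "W_span S"
  note U = W_span(1)[OF S]
  have full: "rank W_module S = CARD('n) \<longleftrightarrow> vec.span (components ` ?U) = UNIV"
    using vec.dim_eq_full[of "components ` ?U"]
    by (simp add: rank_W_module[OF S] vec.dimension_def card_cart_basis)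
  show ?thesis
    unfolding full
  proof
    assume "vec.span (components ` ?U) = UNIV"
    then have "\<exists>p. p \<noteq> 0 \<and> (\<lambda>f. p * pderiv_mpoly i f) \<in> ?U" for i
      by (intro multiple_in_polynomial_if_components_in_span U pderiv_mpoly_derivation) auto
    then obtain p where p: "\<And>i. p i \<noteq> 0" "\<And>i. (\<lambda>f. p i * pderiv_mpoly i f) \<in> ?U" by metis
    have U0: "zero_der \<in> ?U"
      and Uadd: "\<And>D E. D \<in> ?U \<Longrightarrow> E \<in> ?U \<Longrightarrow> (\<lambda>f. D f + E f) \<in> ?U"
      and Usmult: "\<And>p D. D \<in> ?U \<Longrightarrow> (\<lambda>f. p * D f) \<in> ?U"
      using U by (auto simp: polynomial_iff)
    let ?p = "\<Prod>i\<in>UNIV. p i"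
    have "(\<lambda>f. ?p * D f) \<in> ?U" if D: "D \<in> derivations" for D
    proof -
      \<comment> \<open>The coefficient of p i times the i-th partial derivative in the expansion of
        \<open>?p\<close> times D.\<close>
      let ?q = "\<lambda>i. D (var i) * (\<Prod>j\<in>UNIV - {i}. p j)"
      have mem: "(\<lambda>f. \<Sum>i\<in>I. ?q i * (p i * pderiv_mpoly i f)) \<in> ?U" for I
      proof (induction I rule: infinite_finite_induct)
        case (insert i I)
        then show ?case
          using Uadd[OF Usmult[OF p(2), of "?q i" i] insert.IH] by simp
      qed (simp_all add: U0)
      have "(\<lambda>f. \<Sum>i\<in>UNIV. ?q i * (p i * pderiv_mpoly i f)) = (\<lambda>f. ?p * D f)"
      proof
        fix f
        have "?q i * (p i * pderiv_mpoly i f) = ?p * (D (var i) * pderiv_mpoly i f)" for i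
          by (subst prod.remove[of UNIV i p]) (simp_all add: mult_ac)
        then show "(\<Sum>i\<in>UNIV. ?q i * (p i * pderiv_mpoly i f)) = ?p * D f"
          using fun_cong[OF derivation_expansion[OF D], of f] by (simp only: sum_distrib_left)
      qed
      from mem[of UNIV, unfolded this] show ?thesis .
    qed
    moreover have "?p \<noteq> 0" using p(1) by simp
    ultimately show ?R by blast
  next
    assume ?R
    then obtain p where p: "p \<noteq> 0" "\<And>D. D \<in> derivations \<Longrightarrow> (\<lambda>f. p * D f) \<in> ?U" by blast
    have "axis i 1 \<in> vec.span (components ` ?U)" for i :: 'n
    proof -
      have "Fract p 1 *s axis i 1 \<in> components ` ?U"
        using p(2)[OF pderiv_mpoly_derivation[of i]]
        by (metis components_pderiv components_smult image_eqI)
      then have "Fract 1 p *s (Fract p 1 *s axis i 1) \<in> vec.span (components ` ?U)"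
        by (intro vec.span_scale vec.span_base)
      moreover have "Fract 1 p * Fract p 1 = 1"
        using p(1) by (simp add: eq_fract One_fract_def)
      ultimately show ?thesis by (simp only: vec.scale_scale vec.scale_one)
    qed
    then have "cart_basis \<subseteq> vec.span (components ` ?U)"
      by (auto simp: cart_basis_def)
    then have "vec.span cart_basis \<subseteq> vec.span (components ` ?U)"
      by (intro vec.span_minimal vec.subspace_span)
    then show "vec.span (components ` ?U) = UNIV" by auto
  qed
qed

section \<open>Maximal subalgebras\<close>

lemma polynomialD:
  fixes U :: "(('n::linorder, 'k::field) mpoly \<Rightarrow> ('n, 'k) mpoly) set"
  assumes "polynomial U"
  shows "D \<in> U \<Longrightarrow> D \<in> derivations" "zero_der \<in> U"
    "D \<in> U \<Longrightarrow> E \<in> U \<Longrightarrow> (\<lambda>f. D f + E f) \<in> U" "D \<in> U \<Longrightarrow> (\<lambda>f. p * D f) \<in> U"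
    "D \<in> U \<Longrightarrow> E \<in> U \<Longrightarrow> (\<lambda>f. D f - E f) \<in> U"
proof -
  show *: "D \<in> U \<Longrightarrow> D \<in> derivations" "zero_der \<in> U"
    "\<And>D E. D \<in> U \<Longrightarrow> E \<in> U \<Longrightarrow> (\<lambda>f. D f + E f) \<in> U" "\<And>p D. D \<in> U \<Longrightarrow> (\<lambda>f. p * D f) \<in> U"
    for D using assms by (auto simp: polynomial_iff)
  show "D \<in> U \<Longrightarrow> E \<in> U \<Longrightarrow> (\<lambda>f. D f - E f) \<in> U"
    using *(3)[OF _ *(4)[of E "-1"], of D] by simp
qed

lemma polynomialI:
  fixes U :: "(('n::linorder, 'k::field) mpoly \<Rightarrow> ('n, 'k) mpoly) set"
  assumes "U \<subseteq> derivations" "zero_der \<in> U" "\<And>D E. D \<in> U \<Longrightarrow> E \<in> U \<Longrightarrow> (\<lambda>f. D f + E f) \<in> U"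
    "\<And>p D. D \<in> U \<Longrightarrow> (\<lambda>f. p * D f) \<in> U"
  shows "polynomial U"
  using assms by (simp add: polynomial_iff)

lemma W_span_polynomial:
  fixes U :: "(('n::linorder, 'k::field) mpoly \<Rightarrow> ('n, 'k) mpoly) set"
  shows "polynomial U \<Longrightarrow> W_span U = U"
  using W_span[of U] polynomialD(1)[of U] by blast

lemma bracket_in_polynomial_commute:
  fixes U :: "(('n::linorder, 'k::field) mpoly \<Rightarrow> ('n, 'k) mpoly) set"
  assumes "polynomial U" "bracket_der D E \<in> U"
  shows "bracket_der E D \<in> U"
  using polynomialD(4)[OF assms, of "-1"] by simp

section \<open>Brackets and polynomial spans\<close>

lemma bracket_der_mult:
  assumes "D \<in> derivations"
  shows "bracket_der D (\<lambda>f. p * E f) = (\<lambda>f. D p * E f + p * bracket_der D E f)"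
  using derivationsD(3)[OF assms] by (auto simp: algebra_simps)

text \<open>The E in U with [D, E] in U form a polynomial submodule: in [D, p E] = D(p) E + p [D, E]
  the first term stays in U because E does.\<close>

lemma bracket_W_span:
  fixes U :: "(('n::linorder, 'k::field) mpoly \<Rightarrow> ('n, 'k) mpoly) set"
  assumes D: "D \<in> derivations" and U: "polynomial U" and S: "S \<subseteq> U"
    and br: "\<And>E. E \<in> S \<Longrightarrow> bracket_der D E \<in> U" and E: "E \<in> W_span S"
  shows "bracket_der D E \<in> U"
proof -
  have "polynomial {E \<in> U. bracket_der D E \<in> U}"
  proof (rule polynomialI)
    show "{E \<in> U. bracket_der D E \<in> U} \<subseteq> derivations"
      using polynomialD(1)[OF U] by blast
    show "zero_der \<in> {E \<in> U. bracket_der D E \<in> U}"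
      using polynomialD(2)[OF U] D by (simp add: derivations_zero)
  next
    fix E E' assume E: "E \<in> {E \<in> U. bracket_der D E \<in> U}" "E' \<in> {E \<in> U. bracket_der D E \<in> U}"
    have "bracket_der D (\<lambda>f. E f + E' f) = (\<lambda>f. bracket_der D E f + bracket_der D E' f)"
      using derivationsD(1)[OF D] by (auto simp: algebra_simps)
    then show "(\<lambda>f. E f + E' f) \<in> {E \<in> U. bracket_der D E \<in> U}"
      using E polynomialD(3)[OF U] by auto
  next
    fix p E assume E: "E \<in> {E \<in> U. bracket_der D E \<in> U}"
    then have "bracket_der D (\<lambda>f. p * E f) \<in> U"
      unfolding bracket_der_mult[OF D] by (intro polynomialD(3,4)[OF U]) auto
    then show "(\<lambda>f. p * E f) \<in> {E \<in> U. bracket_der D E \<in> U}"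
      using E polynomialD(4)[OF U] by auto
  qed
  then have "W_span S \<subseteq> {E \<in> U. bracket_der D E \<in> U}"
    using S br polynomialD(1)[OF U] by (intro W_span(3)) auto
  then show ?thesis using E by blast
qed

text \<open>\<open>bracket_W_span\<close> extends closure from S to its span in one argument at a
  time, with antisymmetry exchanging the arguments.\<close>

lemma bracket_W_span_closed:
  fixes S :: "(('n::linorder, 'k::field) mpoly \<Rightarrow> ('n, 'k) mpoly) set"
  assumes S: "S \<subseteq> derivations" and br: "\<And>D E. D \<in> S \<Longrightarrow> E \<in> S \<Longrightarrow> bracket_der D E \<in> S"
    and D: "D \<in> W_span S" and E: "E \<in> W_span S"
  shows "bracket_der D E \<in> W_span S"
proof (rule bracket_W_span[OF _ W_span(1,2)[OF S] _ E])
  show "D \<in> derivations" by (rule polynomialD(1)[OF W_span(1)[OF S] D])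
  fix E assume E: "E \<in> S"
  then have "bracket_der E D \<in> W_span S"
    using S br W_span(2)[OF S] by (intro bracket_W_span[OF _ W_span(1,2)[OF S] _ D]) auto
  then show "bracket_der D E \<in> W_span S"
    by (rule bracket_in_polynomial_commute[OF W_span(1)[OF S]])
qed

lemma lie_subalgebra_if_polynomial:
  fixes U :: "(('n::linorder, 'k::field) mpoly \<Rightarrow> ('n, 'k) mpoly) set"
  assumes "polynomial U" "\<And>D E. D \<in> U \<Longrightarrow> E \<in> U \<Longrightarrow> bracket_der D E \<in> U"
  shows "lie_subalgebra W_lie U"
  using assms by (auto simp: lie_subalgebra_W_iff polynomial_iff)

section \<open>Small ideals of a maximal subalgebra have polynomial spans inside it\<close>

locale maximal_W_subalgebra =
  fixes M :: "(('n::{finite,linorder}, 'k::field_char_0) mpoly \<Rightarrow> ('n, 'k) mpoly) set"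
  assumes maximal: "maximal_subalgebra W_lie M"
begin

lemma subalgebra: "lie_subalgebra W_lie M"
  and proper: "M \<noteq> derivations"
  and eq_if_above: "lie_subalgebra W_lie S \<Longrightarrow> M \<subseteq> S \<Longrightarrow> S = M \<or> S = derivations"
  using maximal by (auto simp: maximal_subalgebra_def)

lemma M_closed:
  "D \<in> M \<Longrightarrow> D \<in> derivations" "zero_der \<in> M" "D \<in> M \<Longrightarrow> E \<in> M \<Longrightarrow> (\<lambda>f. D f + E f) \<in> M"
  "D \<in> M \<Longrightarrow> (\<lambda>f. scalar c * D f) \<in> M" "D \<in> M \<Longrightarrow> E \<in> M \<Longrightarrow> bracket_der D E \<in> M"
  using subalgebra by (auto simp: lie_subalgebra_W_iff)

lemma M_derivations: "M \<subseteq> derivations"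
  using M_closed(1) by blast

lemma polynomial_ideal_iff:
  "polynomial_ideal M I \<longleftrightarrow> I \<subseteq> M \<and> polynomial I \<and> (\<forall>D\<in>M. \<forall>E\<in>I. bracket_der D E \<in> I)"
  unfolding polynomial_ideal_def lie_ideal_W_iff[OF subalgebra]
  by (auto simp: polynomial_iff)

lemma W_span_ideal:
  assumes J: "lie_ideal (W_lie\<lparr>carrier := M\<rparr>) J" and nz: "J \<noteq> {zero_der}"
    and rk: "rank W_module J < CARD('n)"
  shows "polynomial_ideal M (W_span J)"
proof -
  have JM: "J \<subseteq> M" and J_ideal: "\<And>D E. D \<in> M \<Longrightarrow> E \<in> J \<Longrightarrow> bracket_der D E \<in> J"
    and J0: "zero_der \<in> J"
    using J by (auto simp: lie_ideal_W_iff[OF subalgebra])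
  have Jd: "J \<subseteq> derivations" using JM M_derivations by blast
  let ?U = "W_span J"
  note U = W_span(1)[OF Jd] and JU = W_span(2)[OF Jd]
  have brM: "bracket_der D E \<in> ?U" if "D \<in> M" "E \<in> ?U" for D E
    by (rule bracket_W_span[OF M_closed(1)[OF that(1)] U JU subsetD[OF JU J_ideal[OF that(1)]] that(2)])
  have brU: "bracket_der D E \<in> ?U" if "D \<in> ?U" "E \<in> ?U" for D E
    by (rule bracket_W_span_closed[OF Jd J_ideal[OF subsetD[OF JM]] that])
  \<comment> \<open>The sum of M and \<open>?U\<close>. M normalizes \<open>?U\<close> by
    \<open>brM\<close> and \<open>?U\<close> is closed under brackets by \<open>brU\<close>, so this
    is a subalgebra above M.\<close>
  let ?T = "{(\<lambda>f. D f + E f) | D E. D \<in> M \<and> E \<in> ?U}"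
  have T_I: "(\<lambda>f. D f + E f) \<in> ?T" if "D \<in> M" "E \<in> ?U" for D E
    using that by blast
  have MT: "M \<subseteq> ?T"
    using T_I[OF _ polynomialD(2)[OF U]] by (simp add: subset_iff del: mem_Collect_eq)
  have UT: "?U \<subseteq> ?T"
    using T_I[OF M_closed(2)] by (simp add: subset_iff del: mem_Collect_eq)
  have "lie_subalgebra W_lie ?T"
    unfolding lie_subalgebra_W_iff
  proof (intro conjI ballI allI)
    show "?T \<subseteq> derivations"
      using derivations_closed(2)[OF M_closed(1) polynomialD(1)[OF U]] by blast
    show "zero_der \<in> ?T"
      using subsetD[OF MT M_closed(2)] .
  next
    fix X Y assume "X \<in> ?T" "Y \<in> ?T"
    then obtain D E D' E' where X: "X = (\<lambda>f. D f + E f)" "D \<in> M" "E \<in> ?U"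
      and Y: "Y = (\<lambda>f. D' f + E' f)" "D' \<in> M" "E' \<in> ?U" by blast
    have "(\<lambda>f. X f + Y f) = (\<lambda>f. (D f + D' f) + (E f + E' f))"
      by (simp add: X Y algebra_simps)
    with T_I[OF M_closed(3)[OF X(2) Y(2)] polynomialD(3)[OF U X(3) Y(3)]]
    show "(\<lambda>f. X f + Y f) \<in> ?T" by (simp only:)
    have der: "D \<in> derivations" "D' \<in> derivations" "E \<in> derivations" "E' \<in> derivations"
      using X Y M_closed(1) polynomialD(1)[OF U] by auto
    \<comment> \<open>Only [D, D'] is left in M; the two mixed brackets and [E, E'] are collected
      into the summand from \<open>?U\<close>.\<close>
    have "bracket_der X Y = (\<lambda>f. bracket_der D D' f + ((bracket_der D E' f - bracket_der D' E f) + bracket_der E E' f))"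
      by (simp add: X Y derivationsD(1)[OF der(1)] derivationsD(1)[OF der(2)]
          derivationsD(1)[OF der(3)] derivationsD(1)[OF der(4)] algebra_simps)
    with T_I[OF M_closed(5)[OF X(2) Y(2)] polynomialD(3)[OF U
          polynomialD(5)[OF U brM[OF X(2) Y(3)] brM[OF Y(2) X(3)]] brU[OF X(3) Y(3)]]]
    show "bracket_der X Y \<in> ?T" by (simp only:)
  next
    fix c X assume "X \<in> ?T"
    then obtain D E where X: "X = (\<lambda>f. D f + E f)" "D \<in> M" "E \<in> ?U" by blast
    have "(\<lambda>f. scalar c * X f) = (\<lambda>f. scalar c * D f + scalar c * E f)"
      by (simp add: X algebra_simps)
    with T_I[OF M_closed(4)[OF X(2)] polynomialD(4)[OF U X(3)]]
    show "(\<lambda>f. scalar c * X f) \<in> ?T" by (simp only:)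
  qed
  moreover have "?T \<noteq> derivations"
  proof
    assume T: "?T = derivations"
    \<comment> \<open>If the sum is everything, then \<open>?U\<close>, being normalized by M and by
      itself, is an ideal of W_n.\<close>
    have W_ideal: "bracket_der E D \<in> ?U" if E: "E \<in> derivations" and D: "D \<in> ?U" for E D
    proof -
      obtain A B where E: "E = (\<lambda>f. A f + B f)" "A \<in> M" "B \<in> ?U" using E T by blast
      have "bracket_der E D = (\<lambda>f. bracket_der A D f + bracket_der B D f)"
        by (simp add: E derivationsD(1)[OF polynomialD(1)[OF U D]] algebra_simps)
      then show ?thesis
        using polynomialD(3)[OF U brM[OF E(2) D] brU[OF E(3) D]] by simp
    qed
    obtain D g where D: "D \<in> J" and g: "D g \<noteq> 0"
    proof -
      from nz J0 obtain D where "D \<in> J" "D \<noteq> zero_der" by blast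
      then show thesis using that[of D] by (auto simp: fun_eq_iff)
    qed
    have Dd: "D \<in> derivations" using D Jd by blast
    \<comment> \<open>D(g) E = [D, g E] - g [D, E], where both brackets lie in the ideal
      \<open>?U\<close>. Thus the nonzero polynomial D g multiplies all of W_n into
      \<open>?U\<close>, which forces full rank.\<close>
    have "(\<lambda>f. D g * E f) \<in> ?U" if E: "E \<in> derivations" for E
    proof -
      have D': "D \<in> ?U" using D JU by blast
      have "(\<lambda>f. D g * E f + g * bracket_der D E f) \<in> ?U"
        using bracket_in_polynomial_commute[OF U W_ideal[OF derivations_closed(3)[OF E] D'], of g]
        unfolding bracket_der_mult[OF Dd] .
      from polynomialD(5)[OF U this polynomialD(4)[OF U
            bracket_in_polynomial_commute[OF U W_ideal[OF E D']], of g]]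
      show ?thesis by simp
    qed
    then have "rank W_module J = CARD('n)"
      using rank_W_module_eq_iff[OF Jd] g by blast
    then show False using rk by simp
  qed
  ultimately have "?T = M" using eq_if_above[of ?T] MT by blast
  then have "?U \<subseteq> M" using UT by blast
  then show ?thesis
    unfolding polynomial_ideal_iff using U brM by blast
qed

section \<open>The largest polynomial ideal of M\<close>

definition core where
  "core = {D \<in> M. \<forall>p. (\<lambda>f. p * D f) \<in> M}"

text \<open>A polynomial I contains all multiples of its elements, and I lies in M. With
  \<open>polynomial_ideal_core\<close> this makes \<open>core\<close> the greatest polynomial ideal,
  so it is the only one that is maximal by inclusion.\<close>

lemma core_greatest: "polynomial I \<Longrightarrow> I \<subseteq> M \<Longrightarrow> I \<subseteq> core"
  unfolding core_def using polynomialD(4) by blast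

text \<open>For the ideal property, p [D, E] = [D, p E] - D(p) E, and M contains both terms because
  it contains every multiple of E.\<close>

lemma polynomial_ideal_core: "polynomial_ideal M core"
  unfolding polynomial_ideal_iff
proof (intro conjI ballI polynomialI)
  show "core \<subseteq> M" "core \<subseteq> derivations" using M_derivations by (auto simp: core_def)
  show "zero_der \<in> core" using M_closed(2) by (simp add: core_def)
  show "(\<lambda>f. D f + E f) \<in> core" if "D \<in> core" "E \<in> core" for D E
    using that M_closed(3) by (auto simp: core_def distrib_left)
  show "(\<lambda>f. p * D f) \<in> core" if "D \<in> core" for p D
    using that by (simp add: core_def mult.assoc[symmetric])
  show "bracket_der D E \<in> core" if D: "D \<in> M" and E: "E \<in> core" for D E
  proof -
    have mult: "(\<lambda>f. p * E f) \<in> M" for p using E by (simp add: core_def)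
    have "(\<lambda>f. p * bracket_der D E f) \<in> M" for p
    proof -
      have "(\<lambda>f. D p * E f + p * bracket_der D E f) \<in> M"
        using M_closed(5)[OF D mult[of p]] unfolding bracket_der_mult[OF M_closed(1)[OF D]] .
      from M_closed(3)[OF this mult[of "- D p"]] show ?thesis by simp
    qed
    then show ?thesis
      using M_closed(5)[OF D] E by (simp add: core_def)
  qed
qed

lemma maximal_polynomial_ideal_iff: "maximal_polynomial_ideal M I \<longleftrightarrow> I = core"
  unfolding maximal_polynomial_ideal_def
  using polynomial_ideal_core core_greatest by (metis polynomial_ideal_iff subset_antisym)

lemma rank_core:
  assumes "\<not> polynomial M"
  shows "rank W_module core < CARD('n)"
proof (rule ccontr)
  have core: "core \<subseteq> M" "polynomial core" "\<And>D E. D \<in> M \<Longrightarrow> E \<in> core \<Longrightarrow> bracket_der D E \<in> core"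
    using polynomial_ideal_core by (auto simp: polynomial_ideal_iff)
  have core_der: "core \<subseteq> derivations" using core(1) M_derivations by blast
  assume "\<not> rank W_module core < CARD('n)"
  then have "rank W_module core = CARD('n)"
    using rank_W_module_le[OF core_der] by linarith
  then obtain p where p: "p \<noteq> 0" "\<And>D. D \<in> derivations \<Longrightarrow> (\<lambda>f. p * D f) \<in> core"
    unfolding rank_W_module_eq_iff[OF core_der] W_span_polynomial[OF core(2)] by blast
  \<comment> \<open>The polynomials multiplying W_n into \<open>core\<close>: an ideal of the
    polynomial ring, nonzero because it contains p.\<close>
  define C where "C = {p. \<forall>D\<in>derivations. (\<lambda>f. p * D f) \<in> core}"
  have C_add: "f + g \<in> C" if "f \<in> C" "g \<in> C" for f g
    using that polynomialD(3)[OF core(2)] by (auto simp: C_def distrib_right)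
  have C_mult: "f * g \<in> C" if "g \<in> C" for f g
    using that polynomialD(4)[OF core(2)] by (auto simp: C_def mult.assoc)
  \<comment> \<open>As C is an ideal, the derivations preserving it form a polynomial submodule;
    once it contains M it contains \<open>W_span M\<close>.\<close>
  have "polynomial {D \<in> derivations. \<forall>p\<in>C. D p \<in> C}"
  proof (rule polynomialI)
    show "zero_der \<in> {D \<in> derivations. \<forall>p\<in>C. D p \<in> C}"
      using polynomialD(2)[OF core(2)] derivations_closed(1) by (auto simp: C_def)
  qed (auto simp: derivations_closed C_add C_mult)
  moreover have "M \<subseteq> {D \<in> derivations. \<forall>p\<in>C. D p \<in> C}"
  proof safe
    fix D p assume D: "D \<in> M" and p: "p \<in> C"
    show "D p \<in> C"
      unfolding C_def
    proof safe
      fix E :: "('n, 'k) mpoly \<Rightarrow> ('n, 'k) mpoly" assume E: "E \<in> derivations"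
      then have "(\<lambda>f. p * E f) \<in> core" and pbr: "(\<lambda>f. p * bracket_der D E f) \<in> core"
        using p derivations_closed(4)[OF M_closed(1)[OF D] E] by (auto simp: C_def)
      \<comment> \<open>The bracket [D, p E] is in \<open>core\<close>; subtracting p [D, E], which
        is there because p is in C, leaves D(p) E.\<close>
      from core(3)[OF D this(1)] have "(\<lambda>f. D p * E f + p * bracket_der D E f) \<in> core"
        unfolding bracket_der_mult[OF M_closed(1)[OF D]] .
      from polynomialD(5)[OF core(2) this pbr] show "(\<lambda>f. D p * E f) \<in> core" by simp
    qed
  qed (rule M_closed(1))
  ultimately have span: "W_span M \<subseteq> {D \<in> derivations. \<forall>p\<in>C. D p \<in> C}"
    by (intro W_span(3)[OF M_derivations])
  have "lie_subalgebra W_lie (W_span M)"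
    by (rule lie_subalgebra_if_polynomial[OF W_span(1)[OF M_derivations]
          bracket_W_span_closed[OF M_derivations M_closed(5)]])
  \<comment> \<open>\<open>W_span M\<close> is a polynomial subalgebra above M. Since M is not
    polynomial it differs from M, and maximality leaves only W_n.\<close>
  then have "W_span M = derivations"
    using eq_if_above[of "W_span M"] W_span(1,2)[OF M_derivations] assms by auto
  then have "pderiv_mpoly i f \<in> C" if "f \<in> C" for i f
    using span pderiv_mpoly_derivation[of i] that by blast
  from one_in_differential_ideal[OF C_add C_mult this _ p(1)] have "1 \<in> C"
    using p(2) by (simp add: C_def)
  then have "derivations \<subseteq> core"
    by (simp add: C_def subset_iff)
  then show False using core(1) M_derivations proper by blast
qed

end

section \<open>The quotient of M by its largest polynomial ideal\<close>

lemma quotient_lie_simps: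
  "carrier (quotient_lie L U) = carrier (quotient_module L U)"
  "\<zero>\<^bsub>quotient_lie L U\<^esub> = \<zero>\<^bsub>quotient_module L U\<^esub>"
  "A \<oplus>\<^bsub>quotient_lie L U\<^esub> B = A \<oplus>\<^bsub>quotient_module L U\<^esub> B"
  "r \<odot>\<^bsub>quotient_lie L U\<^esub> A = r \<odot>\<^bsub>quotient_module L U\<^esub> A"
  "bracket (quotient_lie L U) A B = (\<Union>a\<in>A. \<Union>b\<in>B. U +>\<^bsub>L\<^esub> bracket L a b)"
  by (simp_all add: quotient_lie_def quotient_module_def module.defs lie_algebra.defs)

context maximal_W_subalgebra
begin

abbreviation "M_lie \<equiv> W_lie\<lparr>carrier := M\<rparr>"
abbreviation "coset D \<equiv> core +>\<^bsub>W_module\<^esub> D"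

text \<open>Cosets depend on addition alone, which both records share. So an ideal of the Lie
  quotient of M is also a subset of the module quotient of W_n, where its rank is taken.\<close>

lemma coset_M_lie: "core +>\<^bsub>M_lie\<^esub> D = coset D"
  by (simp add: a_r_coset_def')

lemma coset_eq: "coset D = {(\<lambda>f. C f + D f) | C. C \<in> core}"
  by (auto simp: a_r_coset_def')

lemma coset_I: "C \<in> core \<Longrightarrow> (\<lambda>f. C f + D f) \<in> coset D"
  by (auto simp: coset_eq)

lemma core_closed:
  "core \<subseteq> M" "polynomial core" "D \<in> M \<Longrightarrow> E \<in> core \<Longrightarrow> bracket_der D E \<in> core"
  using polynomial_ideal_core by (auto simp: polynomial_ideal_iff)

lemma module_quotient_M_lie: "module_quotient class_ring M_lie core"
proof (intro module_quotient.intro module_quotient_axioms.intro)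
  show "Module.module class_ring M_lie"
    using subalgebra unfolding lie_subalgebra_def
    by (intro module.submodule_is_module[OF module_W_lie]) auto
  show "submodule class_ring core M_lie"
    using polynomial_ideal_core unfolding polynomial_ideal_def lie_ideal_def by blast
qed

sublocale QL: module_quotient class_ring M_lie core
  by (rule module_quotient_M_lie)

text \<open>The quotient bracket is a union over representatives D' = A + D and E' = B + E. It
  collapses because [D', E'] = [D', B] + [A, E] + [D, E], with the first two terms in the ideal
  \<open>core\<close>.\<close>

lemma bracket_coset:
  assumes D: "D \<in> M" and E: "E \<in> M"
  shows "bracket (quotient_lie M_lie core) (coset D) (coset E) = coset (bracket_der D E)"
proof -
  have "coset (bracket_der D' E') = coset (bracket_der D E)"
    if "D' \<in> coset D" "E' \<in> coset E" for D' E'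
  proof -
    from that obtain A B where A: "A \<in> core" "D' = (\<lambda>f. A f + D f)"
      and B: "B \<in> core" "E' = (\<lambda>f. B f + E f)" by (auto simp: coset_eq)
    have AM: "A \<in> M" "B \<in> M" using A B core_closed(1) by auto
    have D'M: "D' \<in> M" "E' \<in> M" unfolding A(2) B(2) using M_closed(3) AM D E by auto
    have 1: "bracket_der D' B \<in> core" "bracket_der A E \<in> core"
      using core_closed(3)[OF D'M(1) B(1)]
        bracket_in_polynomial_commute[OF core_closed(2) core_closed(3)[OF E A(1)]] by auto
    have eq: "bracket_der D' E' = (\<lambda>f. (bracket_der D' B f + bracket_der A E f) + bracket_der D E f)"
      using derivationsD(1)[OF M_closed(1)[OF D'M(1)]] derivationsD(1)[OF M_closed(1)[OF E]]
      by (simp add: A(2) B(2) algebra_simps)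
    let ?C = "\<lambda>f. bracket_der D' B f + bracket_der A E f"
    have C: "?C \<in> core" by (rule polynomialD(3)[OF core_closed(2) 1])
    have br: "bracket_der D E \<in> M" by (rule M_closed(5)[OF D E])
    have "(\<lambda>f. ?C f + bracket_der D E f) \<in> core +>\<^bsub>M_lie\<^esub> bracket_der D E"
      unfolding coset_M_lie by (rule coset_I[OF C])
    then have "bracket_der D' E' \<in> core +>\<^bsub>M_lie\<^esub> bracket_der D E"
      by (simp only: eq)
    then show ?thesis
      using QL.sub.a_repr_independence'[of "bracket_der D' E'" "bracket_der D E"] br
      by (simp add: coset_M_lie)
  qed
  moreover have "coset D \<noteq> {}" "coset E \<noteq> {}"
    using polynomialD(2)[OF core_closed(2)] by (auto simp: coset_eq)
  ultimately show ?thesis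
    unfolding quotient_lie_simps by (simp add: coset_M_lie)
qed

lemma rank_ideal_quotient:
  assumes M: "\<not> polynomial M"
    and J: "lie_ideal (quotient_lie M_lie core) J" and nz: "J \<noteq> {\<zero>\<^bsub>quotient_lie M_lie core\<^esub>}"
  shows "CARD('n) - rank W_module core \<le> rank (quotient_module W_module core) J"
proof (rule ccontr)
  let ?Q = "quotient_lie M_lie core"
  assume small: "\<not> CARD('n) - rank W_module core \<le> rank (quotient_module W_module core) J"
  have J_sub: "submodule class_ring J ?Q"
    and J_br: "\<And>a b. a \<in> carrier ?Q \<Longrightarrow> b \<in> J \<Longrightarrow> bracket ?Q a b \<in> J"
    using J by (auto simp: lie_ideal_def)
  have zero: "\<zero>\<^bsub>?Q\<^esub> = coset zero_der"
    using QL.zero_quot by (simp add: quotient_lie_simps coset_M_lie)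
  have carrier: "carrier ?Q = coset ` M"
    using QL.carrier_quot by (simp add: quotient_lie_simps coset_M_lie)
  have add: "coset D \<oplus>\<^bsub>?Q\<^esub> coset E = coset (\<lambda>f. D f + E f)" if "D \<in> M" "E \<in> M" for D E
    using QL.add_quot[of D E] that by (simp add: quotient_lie_simps coset_M_lie)
  have smult: "c \<odot>\<^bsub>?Q\<^esub> coset D = coset (\<lambda>f. scalar c * D f)" if "D \<in> M" for c D
    using QL.smult_quot[of c D] that by (simp add: quotient_lie_simps coset_M_lie)
  \<comment> \<open>The preimage of J is an ideal of M that contains \<open>core\<close> properly;
    the aim is to show that its span is a polynomial ideal, which is too large for
    \<open>core\<close>.\<close>
  define X where "X = {D \<in> M. coset D \<in> J}"
  have JX: "J = coset ` X"
    using submodule.subset[OF J_sub] unfolding carrier X_def by blast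
  have X: "lie_ideal M_lie X"
    unfolding lie_ideal_W_iff[OF subalgebra]
  proof (intro conjI ballI allI)
    show "X \<subseteq> M" by (auto simp: X_def)
    show "zero_der \<in> X"
      using submodule.zero_closed[OF J_sub] M_closed(2) by (simp add: X_def zero)
    show "(\<lambda>f. D f + E f) \<in> X" if "D \<in> X" "E \<in> X" for D E
      using that submodule.m_closed[OF J_sub, of "coset D" "coset E"] M_closed(3)
      by (simp add: X_def add)
    show "(\<lambda>f. scalar c * D f) \<in> X" if "D \<in> X" for c D
      using that submodule.smult_closed[OF J_sub, of c "coset D"] M_closed(4)
      by (simp add: X_def smult)
    show "bracket_der D E \<in> X" if "D \<in> M" "E \<in> X" for D E
      using that J_br[of "coset D" "coset E"] M_closed(5)[of D E]
      by (simp add: X_def bracket_coset carrier)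
  qed
  have XM: "X \<subseteq> M" by (auto simp: X_def)
  then have Xd: "X \<subseteq> derivations" using M_derivations by blast
  have coset_core: "coset D = \<zero>\<^bsub>?Q\<^esub>" if "D \<in> core" for D
  proof -
    have "D \<in> core +>\<^bsub>M_lie\<^esub> zero_der"
      unfolding coset_M_lie coset_eq using that by auto
    then show ?thesis
      using QL.sub.a_repr_independence'[of D zero_der] M_closed(2) by (simp add: coset_M_lie zero)
  qed
  have core_X: "core \<subseteq> X"
    using core_closed(1) coset_core submodule.zero_closed[OF J_sub] by (auto simp: X_def)
  have not_core: "\<not> X \<subseteq> core"
  proof
    assume "X \<subseteq> core"
    then have "J \<subseteq> {\<zero>\<^bsub>?Q\<^esub>}" unfolding JX using coset_core by blast
    then show False using nz submodule.zero_closed[OF J_sub] by blast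
  qed
  have X_nz: "X \<noteq> {zero_der}"
    using not_core polynomialD(2)[OF core_closed(2)] by auto
  \<comment> \<open>A and B provide the finiteness that the rank inequality for quotients asks
    for.\<close>
  obtain A where A: "rationally_spanning W_module A core"
    by (rule rationally_spanning_exists[OF core_closed(2)])
  obtain B where B: "rationally_spanning W_module B (W_span X)"
    by (rule rationally_spanning_exists[OF W_span(1)[OF Xd]])
  have "rank W_module X \<le> rank W_module core + rank (quotient_module W_module core) J"
    unfolding JX
    by (rule rank_le_rank_quotient[OF module_W_module core_closed(2)[unfolded polynomial_def] _ core_X A B])
      (simp add: Xd)
  \<comment> \<open>By \<open>small\<close> the rank of J is below the difference n - rank
    \<open>core\<close>. That difference is therefore positive, so truncated subtraction is
    harmless.\<close>
  then have "rank W_module X < CARD('n)"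
    using small by linarith
  from W_span_ideal[OF X X_nz this] have "W_span X \<subseteq> core"
    by (intro core_greatest) (auto simp: polynomial_ideal_iff)
  then show False
    using W_span(2)[OF Xd] not_core by blast
qed

end

section \<open>Principal ideals times W_n\<close>

lemma ideal_times_W_principal:
  fixes p :: "('n::linorder, 'k::field) mpoly"
  shows "ideal_times_W (range (\<lambda>q. q * p)) = (\<lambda>D f. p * D f) ` derivations"
proof
  show "ideal_times_W (range (\<lambda>q. q * p)) \<subseteq> (\<lambda>D f. p * D f) ` derivations"
  proof
    fix X assume "X \<in> ideal_times_W (range (\<lambda>q. q * p))"
    then obtain m :: nat and h D where X: "X = (\<lambda>f. \<Sum>i<m. h i * D i f)"
      and hD: "\<And>i. i < m \<Longrightarrow> h i \<in> range (\<lambda>q. q * p) \<and> D i \<in> derivations"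
      unfolding ideal_times_W_def by blast
    \<comment> \<open>For a principal ideal the factor p comes out of each partial sum: the sum of
      (q_i p) D_i is p times the derivation summing the q_i D_i.\<close>
    have "\<exists>E\<in>derivations. (\<lambda>f. \<Sum>i<k. h i * D i f) = (\<lambda>f. p * E f)" if "k \<le> m" for k
      using that
    proof (induction k)
      case 0
      show ?case by (intro bexI[of _ zero_der]) (auto simp: derivations_closed)
    next
      case (Suc k)
      then obtain E where E: "E \<in> derivations" "(\<lambda>f. \<Sum>i<k. h i * D i f) = (\<lambda>f. p * E f)" by auto
      obtain q where q: "h k = q * p" using hD[of k] Suc.prems by auto
      have "(\<lambda>f. \<Sum>i<Suc k. h i * D i f) = (\<lambda>f. p * (E f + q * D k f))"
        using fun_cong[OF E(2)] by (auto simp: q algebra_simps)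
      moreover have "(\<lambda>f. E f + q * D k f) \<in> derivations"
        using E(1) hD[of k] Suc.prems by (intro derivations_closed) auto
      ultimately show ?case
        by (intro bexI[of _ "\<lambda>f. E f + q * D k f"])
    qed
    then show "X \<in> (\<lambda>D f. p * D f) ` derivations" unfolding X by blast
  qed
  show "(\<lambda>D f. p * D f) ` derivations \<subseteq> ideal_times_W (range (\<lambda>q. q * p))"
  proof safe
    fix D :: "('n, 'k) mpoly \<Rightarrow> ('n, 'k) mpoly" assume D: "D \<in> derivations"
    have "p \<in> range (\<lambda>q. q * p)" by (intro range_eqI[of _ _ 1]) simp
    then show "(\<lambda>f. p * D f) \<in> ideal_times_W (range (\<lambda>q. q * p))"
      unfolding ideal_times_W_def using D
      by (intro CollectI exI[of _ 1] exI[of _ "\<lambda>_. p"] exI[of _ "\<lambda>_. D"]) auto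
  qed
qed

lemma ideal_range_mult: "ideal (range (\<lambda>q. q * p)) (class_ring :: 'a::comm_ring_1 ring)"
proof -
  have "range (\<lambda>q. q * p) = PIdl\<^bsub>class_ring\<^esub> p" by (auto simp: cgenideal_def)
  then show ?thesis using cring.cgenideal_ideal[OF class_cring.cring_axioms, of p] by simp
qed

text \<open>[p D, p E] is p times the derivation D(p) E - E(p) D + p [D, E], which gives the
  subalgebra; p itself is the multiplier witnessing full rank.\<close>

lemma multiples_of_derivations:
  fixes p :: "('n::{finite,linorder}, 'k::field) mpoly"
  defines "T \<equiv> (\<lambda>D f. p * D f) ` derivations"
  shows "lie_subalgebra W_lie T" "p \<noteq> 0 \<Longrightarrow> rank W_module T = CARD('n)"
proof -
  have T_I: "(\<lambda>f. p * D f) \<in> T" if "D \<in> derivations" for D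
    using that by (simp add: T_def)
  have T: "polynomial T"
  proof (rule polynomialI)
    show "T \<subseteq> derivations" by (auto simp: T_def derivations_closed)
    show "zero_der \<in> T" using T_I[OF derivations_closed(1)] by simp
    show "(\<lambda>f. D f + E f) \<in> T" if "D \<in> T" "E \<in> T" for D E
      using that T_I[OF derivations_closed(2)] by (auto simp: T_def distrib_left[symmetric])
    show "(\<lambda>f. q * D f) \<in> T" if "D \<in> T" for q D
      using that T_I[OF derivations_closed(3)[of _ q]] by (auto simp: T_def mult.left_commute)
  qed
  have "bracket_der X Y \<in> T" if XY: "X \<in> T" "Y \<in> T" for X Y
  proof -
    obtain D E where D: "D \<in> derivations" "X = (\<lambda>f. p * D f)" and E: "E \<in> derivations" "Y = (\<lambda>f. p * E f)"
      using XY by (auto simp: T_def)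
    have "(\<lambda>f. (D p * E f + p * bracket_der D E f) + (- E p) * D f) \<in> derivations"
      using D(1) E(1) by (intro derivations_closed(2,3,4))
    from T_I[OF this] show ?thesis
      by (simp add: D(2) E(2) derivationsD(3)[OF D(1)] derivationsD(3)[OF E(1)] algebra_simps)
  qed
  then show "lie_subalgebra W_lie T" by (rule lie_subalgebra_if_polynomial[OF T])
  show "rank W_module T = CARD('n)" if "p \<noteq> 0"
  proof -
    have "T \<subseteq> derivations" using polynomialD(1)[OF T] by blast
    from rank_W_module_eq_iff[OF this] show ?thesis
      using that T_I unfolding W_span_polynomial[OF T] by blast
  qed
qed

theorem theorem2:
  fixes M :: "(('n::{finite, linorder}, 'k::{alg_closed_field, field_char_0}) mpoly
                 \<Rightarrow> ('n, 'k) mpoly) set"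
  assumes "maximal_subalgebra W_lie M"
    and "rank W_module M = CARD('n)"
  shows
    "(\<not> polynomial M \<and>
      (\<exists>I. lie_ideal (W_lie\<lparr>carrier := M\<rparr>) I \<and> I \<noteq> {\<zero>\<^bsub>W_lie\<^esub>} \<and>
           rank W_module I \<le> CARD('n) - 1)
      \<longrightarrow>
      (\<exists>!M0. maximal_polynomial_ideal M M0) \<and>
      (\<forall>M0. maximal_polynomial_ideal M M0 \<longrightarrow>
        (\<exists>k<CARD('n). rank W_module M0 = k \<and>
          \<not> (\<exists>J. lie_ideal (quotient_lie (W_lie\<lparr>carrier := M\<rparr>) M0) J \<and>
                 J \<noteq> {\<zero>\<^bsub>quotient_lie (W_lie\<lparr>carrier := M\<rparr>) M0\<^esub>} \<and>
                 rank (quotient_module W_module M0) J < CARD('n) - k))))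
     \<and>
     (polynomial M \<longrightarrow>
      (\<exists>I. ideal I class_ring \<and>
           lie_subalgebra W_lie (ideal_times_W I) \<and>
           ideal_times_W I \<subseteq> M \<and>
           rank W_module (ideal_times_W I) = CARD('n)))"
proof (intro conjI impI)
  interpret maximal_W_subalgebra M
    by unfold_locales (rule assms(1))
  show "\<exists>!M0. maximal_polynomial_ideal M M0"
    by (simp add: maximal_polynomial_ideal_iff)
  assume "\<not> polynomial M \<and>
      (\<exists>I. lie_ideal (W_lie\<lparr>carrier := M\<rparr>) I \<and> I \<noteq> {\<zero>\<^bsub>W_lie\<^esub>} \<and>
           rank W_module I \<le> CARD('n) - 1)"
  then have M: "\<not> polynomial M" by blast
  \<comment> \<open>Every maximal polynomial ideal is \<open>core\<close>, and k is its
    rank.\<close>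
  show "\<forall>M0. maximal_polynomial_ideal M M0 \<longrightarrow>
        (\<exists>k<CARD('n). rank W_module M0 = k \<and>
          \<not> (\<exists>J. lie_ideal (quotient_lie (W_lie\<lparr>carrier := M\<rparr>) M0) J \<and>
                 J \<noteq> {\<zero>\<^bsub>quotient_lie (W_lie\<lparr>carrier := M\<rparr>) M0\<^esub>} \<and>
                 rank (quotient_module W_module M0) J < CARD('n) - k))"
    using rank_core[OF M] rank_ideal_quotient[OF M] not_less
    unfolding maximal_polynomial_ideal_iff by blast
next
  interpret maximal_W_subalgebra M
    by unfold_locales (rule assms(1))
  assume M: "polynomial M"
  \<comment> \<open>A polynomial M is its own span, so full rank yields a nonzero p with p W_n
    inside M. The ideal generated by p is the required I.\<close>
  obtain p where p: "p \<noteq> 0" "\<And>D. D \<in> derivations \<Longrightarrow> (\<lambda>f. p * D f) \<in> M"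
    using assms(2) unfolding rank_W_module_eq_iff[OF M_derivations] W_span_polynomial[OF M] by blast
  then have "(\<lambda>D f. p * D f) ` derivations \<subseteq> M" by blast
  then show "\<exists>I. ideal I class_ring \<and> lie_subalgebra W_lie (ideal_times_W I) \<and>
      ideal_times_W I \<subseteq> M \<and> rank W_module (ideal_times_W I) = CARD('n)"
    using ideal_range_mult[of p] multiples_of_derivations[of p] p(1)
    by (intro exI[of _ "range (\<lambda>q. q * p)"]) (simp add: ideal_times_W_principal)
qed

end
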